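(* Let $\Lambda=\{\lambda_1,\lambda_2,\ldots\}$ be a countable set of distinct real numbers which has an integral basis, let $f\in\mathcal{D}_{\Lambda}$ be an almost periodic function in an open vertical strip $U$, and let $\sigma_0=\operatorname{Re}s_0$ with $s_0\in U$. Then $$\operatorname{Img}\left(F_f(\sigma_0,\mathbf{x})\right)=\overline{\operatorname{Img}\left(f_1(\sigma_0+it)\right)}$$ for any $f_1\sim f$.
   Context: Almost periodic functions. Let $U=\{s\in\mathbb{C}:\alpha<\operatorname{Re}s<\beta\}$ with $-\infty\le\alpha<\beta\le\infty$. $AP(U,\mathbb{C})$ is the set of functions $f:U\to\mathbb{C}$ which can be approximated uniformly on every reduced strip $\{\alpha_1\le\operatorname{Re}s\le\beta_1\}$, $\alpha<\alpha_1<\beta_1<\beta$, by exponential polynomials $a_1e^{\lambda_1s}+\cdots+a_ne^{\lambda_ns}$ with $a_j\in\mathbb{C}$ and $\lambda_j\in\mathbb{R}$. The Dirichlet series of $f\in AP(U,\mathbb{C})$ is the formal exponential sum $\sum_{\lambda}a(\lambda)e^{\lambda s}$ with $a(\lambda)=\lim_{T\to\infty}\frac{1}{2T}\int_{-T}^{T}f(\sigma+it)e^{-\lambda(\sigma+it)}\,dt$, which does not depend on $\sigma\in(\alpha,\beta)$ and is nonzero for at most countably many real $\lambda$; it determines $f$. The class $\mathcal{D}_\Lambda$. For a countable set $\Lambda=\{\lambda_1,\lambda_2,\ldots\}$ of distinct real numbers, $\mathcal{D}_\Lambda$ consists of the functions $f\in AP(U,\mathbb{C})$ (for such a strip $U$)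 whose Dirichlet series is of the form $\sum_{j\ge1}a_je^{\lambda_js}$, $a_j\in\mathbb{C}$, $\lambda_j\in\Lambda$. Integral basis. An integral basis for $\Lambda$ is a basis $G_\Lambda=\{g_1,g_2,\ldots\}$ of the $\mathbb{Q}$-vector space $V\subset\mathbb{R}$ generated by $\Lambda$ such that every $\lambda_j$ is a finite linear combination of the $g_k$ with integer coefficients: $\lambda_j=\langle\mathbf{r}_j,\mathbf{g}\rangle=\sum_{k=1}^{q_j}r_{j,k}g_k$, $r_{j,k}\in\mathbb{Z}$, $\mathbf{g}=(g_1,g_2,\ldots)$. Equivalence. Two functions in $\mathcal{D}_\Lambda$ (almost periodic in the same strip) with Dirichlet series $\sum_{j\ge1}a_je^{\lambda_js}$ and $\sum_{j\ge1}b_je^{\lambda_js}$ are equivalent (written $\sim$) if there is a $\mathbb{Q}$-linear map $\psi:V\to\mathbb{R}$ such that $b_j=a_je^{i\psi(\lambda_j)}$ for all $j\ge1$. Auxiliary function. Let $f\in\mathcal{D}_\Lambda$ be almost periodic in $U$ with Dirichlet series $\sum_{j\ge1}a_je^{\lambda_js}$, and let $G_\Lambda$ be an integral basis for $\Lambda$. The auxiliary function $F_f:(\alpha,\beta)\times\mathbb{R}^{\sharp G_\Lambda}\to\mathbb{C}$ relative to $G_\Lambda$ is $$F_f(\sigma,\mathbf{x})=\sum_{j\ge1}a_je^{\lambda_j\sigma}e^{i\langle\mathbf{r}_j,\mathbf{x}\rangle},\qquad \langle\mathbf{r}_j,\mathbf{x}\rangle=\sum_{k=1}^{q_j}r_{j,k}x_k,$$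 the series being summed by the Bochner–Fejér procedure, applied at $t=0$ to the exponential sum $\sum_{j\ge1}a_je^{i\langle\mathbf{r}_j,\mathbf{x}\rangle}e^{\lambda_js}$, $s=\sigma+it$. Concretely, it is $\lim_{k\to\infty}\sum_{j}p_{j,k}a_je^{i\langle\mathbf{r}_j,\mathbf{x}\rangle}e^{\lambda_j\sigma}$, where one may take the Bochner–Fejér factors $p_{j,k}=\prod_{m\le k}\left(1-|r_{j,m}|/k!\right)$ if $r_{j,m}=0$ for all $m>k$ and $|r_{j,m}|<k!$ for all $m\le k$, and $p_{j,k}=0$ otherwise (products over $m\le\min(k,\sharp G_\Lambda)$). It is known that for each $\mathbf{x}$ the sum $\sum_{j\ge1}a_je^{i\langle\mathbf{r}_j,\mathbf{x}\rangle}e^{\lambda_js}$ is the Dirichlet series of a unique function $f_{\mathbf{x}}\in AP(U,\mathbb{C})$, so that $F_f(\sigma,\mathbf{x})=f_{\mathbf{x}}(\sigma)$. Image sets. $\operatorname{Img}(f(\sigma_0+it)):=\{f(\sigma_0+it):t\in\mathbb{R}\}$ and $\operatorname{Img}(F_f(\sigma_0,\mathbf{x})):=\{F_f(\sigma_0,\mathbf{x}):\mathbf{x}\in\mathbb{R}^{\sharp G_\Lambda}\}$, where $G_\Lambda$ is any integral basis for $\Lambda$ (the set does not depend on the choice). The bar denotes closure in $\mathbb{C}$. *)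

theory Defs
  imports "HOL-Analysis.Analysis" "HOL-Library.Extended_Nat"
begin

text \<open>
  A function on the strip \<open>\<alpha> < Re s < \<beta>\<close> is rendered as a total function on the complex
  numbers; none of the notions below depends on its values outside the strip.
\<close>

definition vstrip :: "ereal \<Rightarrow> ereal \<Rightarrow> complex set" where
  "vstrip \<alpha> \<beta> = {s. \<alpha> < ereal (Re s) \<and> ereal (Re s) < \<beta>}"

definition exp_polynomial :: "(complex \<Rightarrow> complex) \<Rightarrow> bool" where
  "exp_polynomial P \<longleftrightarrow>
     (\<exists>(n::nat) (a :: nat \<Rightarrow> complex) (l :: nat \<Rightarrow> real).
        \<forall>s. P s = (\<Sum>j<n. a j * exp (complex_of_real (l j) * s)))"

definition AP :: "ereal \<Rightarrow> ereal \<Rightarrow> (complex \<Rightarrow> complex) set" where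
  "AP \<alpha> \<beta> = {f. \<forall>\<alpha>1 \<beta>1 :: real.
      \<alpha> < ereal \<alpha>1 \<longrightarrow> \<alpha>1 < \<beta>1 \<longrightarrow> ereal \<beta>1 < \<beta> \<longrightarrow>
      (\<forall>\<epsilon>>0. \<exists>P. exp_polynomial P \<and>
         (\<forall>s. \<alpha>1 \<le> Re s \<longrightarrow> Re s \<le> \<beta>1 \<longrightarrow> cmod (f s - P s) < \<epsilon>))}"

text \<open>
  For \<open>f \<in> AP \<alpha> \<beta>\<close> the limit exists and does not depend on \<open>\<sigma>\<close>; the coefficient is that
  common value.
\<close>

definition dirichlet_coeff ::
  "ereal \<Rightarrow> ereal \<Rightarrow> (complex \<Rightarrow> complex) \<Rightarrow> real \<Rightarrow> complex" where
  "dirichlet_coeff \<alpha> \<beta> f l = (THE a. \<forall>\<sigma>::real. \<alpha> < ereal \<sigma> \<longrightarrow> ereal \<sigma> < \<beta> \<longrightarrow>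
     ((\<lambda>T::real. complex_of_real (1 / (2 * T)) *
         integral {- T..T} (\<lambda>t. f (Complex \<sigma> t) * exp (- (complex_of_real l * Complex \<sigma> t))))
       \<longlongrightarrow> a) at_top)"

definition D_class :: "ereal \<Rightarrow> ereal \<Rightarrow> real set \<Rightarrow> (complex \<Rightarrow> complex) set" where
  "D_class \<alpha> \<beta> \<Lambda> = {f \<in> AP \<alpha> \<beta>. \<forall>l. dirichlet_coeff \<alpha> \<beta> f l \<noteq> 0 \<longrightarrow> l \<in> \<Lambda>}"

definition rat_scale :: "rat \<Rightarrow> real \<Rightarrow> real" where
  "rat_scale q x = of_rat q * x"

interpretation real_rat: vector_space rat_scale
  by unfold_locales (auto simp: rat_scale_def algebra_simps of_rat_add of_rat_mult)

text \<open>
  A finite or countably infinite basis \<open>{g\<^sub>1, g\<^sub>2, \<dots>}\<close> is given by its cardinality \<open>N\<close> and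
  an enumeration \<open>g\<close> starting at index 0, of which only the values at indices below \<open>N\<close> matter.
\<close>

definition basis_index :: "enat \<Rightarrow> nat set" where
  "basis_index N = {k. enat k < N}"

definition int_combination :: "enat \<Rightarrow> (nat \<Rightarrow> real) \<Rightarrow> real \<Rightarrow> (nat \<Rightarrow> int) \<Rightarrow> bool" where
  "int_combination N g l r \<longleftrightarrow>
     finite {k. r k \<noteq> 0} \<and> {k. r k \<noteq> 0} \<subseteq> basis_index N \<and>
     l = (\<Sum>k\<in>{k. r k \<noteq> 0}. of_int (r k) * g k)"

definition integral_basis :: "real set \<Rightarrow> enat \<Rightarrow> (nat \<Rightarrow> real) \<Rightarrow> bool" where
  "integral_basis \<Lambda> N g \<longleftrightarrow>
     inj_on g (basis_index N) \<and>
     real_rat.independent (g ` basis_index N) \<and>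
     real_rat.span (g ` basis_index N) = real_rat.span \<Lambda> \<and>
     (\<forall>l\<in>\<Lambda>. \<exists>r. int_combination N g l r)"

definition int_coords :: "enat \<Rightarrow> (nat \<Rightarrow> real) \<Rightarrow> real \<Rightarrow> nat \<Rightarrow> int" where
  "int_coords N g l = (THE r. int_combination N g l r)"

definition coords_pairing :: "(nat \<Rightarrow> int) \<Rightarrow> (nat \<Rightarrow> real) \<Rightarrow> real" where
  "coords_pairing r x = (\<Sum>k\<in>{k. r k \<noteq> 0}. of_int (r k) * x k)"

text \<open>The library has linearity only for maps defined on a whole type, not on a subspace.\<close>

definition rat_linear_on :: "real set \<Rightarrow> (real \<Rightarrow> real) \<Rightarrow> bool" where
  "rat_linear_on V \<psi> \<longleftrightarrow>
     (\<forall>x\<in>V. \<forall>y\<in>V. \<psi> (x + y) = \<psi> x + \<psi> y) \<and>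
     (\<forall>q. \<forall>x\<in>V. \<psi> (rat_scale q x) = rat_scale q (\<psi> x))"

definition D_equiv ::
  "ereal \<Rightarrow> ereal \<Rightarrow> real set \<Rightarrow> (complex \<Rightarrow> complex) \<Rightarrow> (complex \<Rightarrow> complex) \<Rightarrow> bool" where
  "D_equiv \<alpha> \<beta> \<Lambda> f1 f2 \<longleftrightarrow>
     f1 \<in> D_class \<alpha> \<beta> \<Lambda> \<and> f2 \<in> D_class \<alpha> \<beta> \<Lambda> \<and>
     (\<exists>\<psi>. rat_linear_on (real_rat.span \<Lambda>) \<psi> \<and>
        (\<forall>l\<in>\<Lambda>. dirichlet_coeff \<alpha> \<beta> f2 l =
           dirichlet_coeff \<alpha> \<beta> f1 l * exp (\<i> * complex_of_real (\<psi> l))))"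

text \<open>
  Bochner-Fejer factors. Indices start at 0, so the first \<open>k\<close> basis elements are those with
  index below \<open>k\<close>.
\<close>

definition bf_factor :: "enat \<Rightarrow> nat \<Rightarrow> (nat \<Rightarrow> int) \<Rightarrow> real" where
  "bf_factor N k r =
     (if (\<forall>m\<ge>k. r m = 0) \<and> (\<forall>m<k. \<bar>r m\<bar> < fact k)
      then (\<Prod>m\<in>{m \<in> basis_index N. m < k}. 1 - of_int \<bar>r m\<bar> / fact k)
      else 0)"

text \<open>
  The sum over \<open>\<Lambda>\<close> is restricted to the terms with nonzero factor; these are finitely many, see
  \<open>finite_bf_support\<close> below.
\<close>

definition bf_sum ::
  "ereal \<Rightarrow> ereal \<Rightarrow> real set \<Rightarrow> enat \<Rightarrow> (nat \<Rightarrow> real) \<Rightarrow> (complex \<Rightarrow> complex) \<Rightarrow> nat \<Rightarrow>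
   real \<Rightarrow> (nat \<Rightarrow> real) \<Rightarrow> complex" where
  "bf_sum \<alpha> \<beta> \<Lambda> N g f k \<sigma> x =
     (\<Sum>l\<in>{l \<in> \<Lambda>. bf_factor N k (int_coords N g l) \<noteq> 0}.
        complex_of_real (bf_factor N k (int_coords N g l)) * dirichlet_coeff \<alpha> \<beta> f l *
        exp (\<i> * complex_of_real (coords_pairing (int_coords N g l) x)) *
        complex_of_real (exp (l * \<sigma>)))"

definition aux_fun ::
  "ereal \<Rightarrow> ereal \<Rightarrow> real set \<Rightarrow> enat \<Rightarrow> (nat \<Rightarrow> real) \<Rightarrow> (complex \<Rightarrow> complex) \<Rightarrow>
   real \<Rightarrow> (nat \<Rightarrow> real) \<Rightarrow> complex" where
  "aux_fun \<alpha> \<beta> \<Lambda> N g f \<sigma> x = lim (\<lambda>k. bf_sum \<alpha> \<beta> \<Lambda> N g f k \<sigma> x)"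

definition img_line :: "(complex \<Rightarrow> complex) \<Rightarrow> real \<Rightarrow> complex set" where
  "img_line f \<sigma> = {f (Complex \<sigma> t) | t. True}"

text \<open>Real \<open>N\<close>-space consists of the extensional real functions on \<open>basis_index N\<close>.\<close>

definition img_aux ::
  "ereal \<Rightarrow> ereal \<Rightarrow> real set \<Rightarrow> enat \<Rightarrow> (nat \<Rightarrow> real) \<Rightarrow> (complex \<Rightarrow> complex) \<Rightarrow>
   real \<Rightarrow> complex set" where
  "img_aux \<alpha> \<beta> \<Lambda> N g f \<sigma> =
     {aux_fun \<alpha> \<beta> \<Lambda> N g f \<sigma> x | x. x \<in> basis_index N \<rightarrow>\<^sub>E UNIV}"

lemma int_combination_unique:
  assumes inj: "inj_on g (basis_index N)"
    and indep: "real_rat.independent (g ` basis_index N)"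
    and r: "int_combination N g l r" and r': "int_combination N g l r'"
  shows "r = r'"
proof
  fix k
  define S where "S = {k. r k \<noteq> 0} \<union> {k. r' k \<noteq> 0}"
  have fin: "finite S" and sub: "S \<subseteq> basis_index N"
    using r r' by (auto simp: S_def int_combination_def)
  have injS: "inj_on g S" using inj sub by (rule inj_on_subset)
  have sum_r: "(\<Sum>k\<in>S. of_int (r k) * g k) = l"
    using r fin by (auto simp: int_combination_def S_def intro!: sum.mono_neutral_right)
  have sum_r': "(\<Sum>k\<in>S. of_int (r' k) * g k) = l"
    using r' fin by (auto simp: int_combination_def S_def intro!: sum.mono_neutral_right)
  define u :: "real \<Rightarrow> rat" where
    "u v = of_int (r (inv_into S g v) - r' (inv_into S g v))" for v
  have u: "u (g k) = of_int (r k - r' k)" if "k \<in> S" for k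
    using that injS by (simp add: u_def)
  have "(\<Sum>v\<in>g ` S. rat_scale (u v) v) = (\<Sum>k\<in>S. rat_scale (u (g k)) (g k))"
    using injS by (simp add: sum.reindex)
  also have "\<dots> = (\<Sum>k\<in>S. of_int (r k) * g k - of_int (r' k) * g k)"
    by (intro sum.cong) (auto simp: u rat_scale_def of_rat_diff algebra_simps)
  also have "\<dots> = 0" by (simp add: sum_subtractf sum_r sum_r')
  finally have z: "(\<Sum>v\<in>g ` S. rat_scale (u v) v) = 0" .
  show "r k = r' k"
  proof (cases "k \<in> S")
    case True
    have "u (g k) = 0"
      by (rule real_rat.independentD[OF indep _ _ z]) (use True fin sub in auto)
    then show ?thesis using u[OF True] by simp
  qed (auto simp: S_def)
qed

lemma int_combination_int_coords:
  assumes "integral_basis \<Lambda> N g" "l \<in> \<Lambda>"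
  shows "int_combination N g l (int_coords N g l)"
proof -
  obtain r where r: "int_combination N g l r"
    using assms by (auto simp: integral_basis_def)
  then show ?thesis unfolding int_coords_def
    by (rule theI[of "int_combination N g l"]) (use assms r int_combination_unique in \<open>auto simp: integral_basis_def\<close>)
qed

lemma finite_bf_support:
  assumes "integral_basis \<Lambda> N g"
  shows "finite {l \<in> \<Lambda>. bf_factor N k (int_coords N g l) \<noteq> 0}" (is "finite ?L")
proof (rule finite_imageD)
  show "inj_on (int_coords N g) ?L"
  proof (rule inj_onI)
    fix l l' assume "l \<in> ?L" "l' \<in> ?L" "int_coords N g l = int_coords N g l'"
    then show "l = l'"
      using int_combination_int_coords[OF assms, of l] int_combination_int_coords[OF assms, of l']
      by (auto simp: int_combination_def)
  qed
  have "int_coords N g ` ?L \<subseteq>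
      {r. \<forall>m. (m \<in> {..<k} \<longrightarrow> r m \<in> {- fact k..fact k}) \<and> (m \<notin> {..<k} \<longrightarrow> r m = 0)}"
    by (force simp: bf_factor_def abs_less_iff split: if_splits)
  then show "finite (int_coords N g ` ?L)"
    by (rule finite_subset) (rule finite_set_of_finite_funs; simp)
qed

end

theory Submission
  imports Defs
begin

text \<open>
  On the line \<open>Re s = \<sigma>\<close> put \<open>h t = f (\<sigma> + it)\<close>. The Bochner-Fejer sums of \<open>h\<close> are its mean
  convolutions with a product of Fejer kernels, which is nonnegative and has mean 1 because the
  basis is rationally independent; so they are contractive in the sup norm, hence uniformly Cauchy,
  and their limit has the same coefficients as \<open>h\<close> and equals \<open>h\<close> by uniqueness.

  Uniqueness: let all coefficients of \<open>h\<close> vanish and let a trigonometric polynomial \<open>p\<close> satisfy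
  \<open>|h - p| \<le> \<epsilon>\<close>. Since \<open>h\<close> is orthogonal to \<open>cnj p |p|^(2n)\<close>, the moments \<open>A n\<close> of \<open>|p|^(2n)\<close>
  satisfy \<open>A (n + 1) \<le> \<epsilon>^2 A n\<close>. As \<open>p^n\<close> has only polynomially many frequencies in \<open>n\<close>,
  Cauchy-Schwarz and Parseval bound \<open>|p|^(2n)\<close> by \<open>\<epsilon>^(2n)\<close> times a polynomial in \<open>n\<close>, so
  \<open>|p| \<le> \<epsilon>\<close>.

  By Kronecker's theorem the line \<open>x = t g\<close> is dense modulo \<open>2\<pi>\<close>, so the Bochner-Fejer sums converge
  uniformly in \<open>x\<close> to a continuous function \<open>F\<close> with \<open>F (t g) = h t\<close>. Density gives
  \<open>range F \<subseteq> closure (range h)\<close>; periodicity makes \<open>range F\<close> the image of the compact set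
  \<open>[0, 2\<pi>]^\<nat>\<close>, which gives the converse. Replacing \<open>f\<close> by an equivalent function only translates
  the variable \<open>x\<close> by \<open>\<psi> \<circ> g\<close>.
\<close>

section \<open>Mean values\<close>

text \<open>A relation rather than a limit operator, so that existence of the mean is proved
  together with its value. The normalisation is that of \<open>dirichlet_coeff\<close>, which can
  therefore be folded into it.\<close>

definition has_mean :: "(real \<Rightarrow> complex) \<Rightarrow> complex \<Rightarrow> bool" where
  "has_mean h c \<longleftrightarrow>
     ((\<lambda>T. complex_of_real (1 / (2 * T)) * integral {- T..T} h) \<longlongrightarrow> c) at_top"

lemma has_mean_unique: "has_mean h c \<Longrightarrow> has_mean h d \<Longrightarrow> c = d"
  unfolding has_mean_def by (rule tendsto_unique[OF trivial_limit_at_top_linorder])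

lemma has_mean_cmult: "has_mean h c \<Longrightarrow> has_mean (\<lambda>t. a * h t) (a * c)"
  unfolding has_mean_def by (drule tendsto_mult_left[of _ _ _ a]) (simp add: mult_ac)

lemma has_mean_add:
  assumes "continuous_on UNIV h" "continuous_on UNIV k" "has_mean h c" "has_mean k d"
  shows "has_mean (\<lambda>t. h t + k t) (c + d)"
proof -
  have "integral {- T..T} (\<lambda>t. h t + k t) = integral {- T..T} h + integral {- T..T} k" for T
    by (intro integral_add integrable_continuous_interval)
      (use assms continuous_on_subset in blast)+
  then show ?thesis
    using tendsto_add[OF assms(3,4)[unfolded has_mean_def]]
    by (simp add: has_mean_def distrib_left)
qed

lemma has_mean_diff:
  assumes "continuous_on UNIV h" "continuous_on UNIV k" "has_mean h c" "has_mean k d"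
  shows "has_mean (\<lambda>t. h t - k t) (c - d)"
  using has_mean_add[OF assms(1) _ assms(3) has_mean_cmult[OF assms(4), of "-1"]] assms(2)
  by (simp add: continuous_on_minus)

lemma has_mean_0: "has_mean (\<lambda>t. 0) 0"
  by (simp add: has_mean_def)

lemma has_mean_sum:
  assumes "finite S" "\<And>i. i \<in> S \<Longrightarrow> continuous_on UNIV (h i)"
    "\<And>i. i \<in> S \<Longrightarrow> has_mean (h i) (c i)"
  shows "has_mean (\<lambda>t. \<Sum>i\<in>S. h i t) (\<Sum>i\<in>S. c i)"
  using assms
proof (induction S)
  case (insert i S)
  then show ?case
    by (simp, intro has_mean_add continuous_on_sum) auto
qed (simp add: has_mean_0)

lemma has_mean_const: "has_mean (\<lambda>t. c) c"
  unfolding has_mean_def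
proof (rule tendsto_eventually, rule eventually_mono[OF eventually_gt_at_top[of 0]])
  fix T :: real assume "T > 0"
  then show "complex_of_real (1 / (2 * T)) * integral {- T..T} (\<lambda>t. c) = c"
    by (simp add: scaleR_conv_of_real)
qed

text \<open>Orthogonality of characters: for \<mu> nonzero the antiderivative has modulus 1 /
  |\<mu>| everywhere, so the integrals stay bounded and the averages decay like 1 / T.\<close>

lemma has_mean_cis: "has_mean (\<lambda>t. cis (\<mu> * t)) (if \<mu> = 0 then 1 else 0)"
proof (cases "\<mu> = 0")
  case False
  have "norm (complex_of_real (1 / (2 * T)) * integral {- T..T} (\<lambda>t. cis (\<mu> * t))) \<le> 1 / (\<bar>\<mu>\<bar> * T)"
    if "T > 0" for T
  proof -
    have "((\<lambda>t. cis (\<mu> * t)) has_integral cis (\<mu> * T) / (\<i> * \<mu>) - cis (\<mu> * - T) / (\<i> * \<mu>)) {- T..T}"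
    proof (rule fundamental_theorem_of_calculus)
      fix t
      show "((\<lambda>t. cis (\<mu> * t) / (\<i> * \<mu>)) has_vector_derivative cis (\<mu> * t)) (at t within {- T..T})"
        unfolding cis_conv_exp of_real_mult
        by (rule has_vector_derivative_real_field) (auto intro!: derivative_eq_intros simp: False mult.left_commute[of \<i>])
    qed (use that in simp)
    then have "norm (integral {- T..T} (\<lambda>t. cis (\<mu> * t))) =
        norm (cis (\<mu> * T) / (\<i> * \<mu>) - cis (\<mu> * - T) / (\<i> * \<mu>))"
      by (simp add: integral_unique)
    also have "\<dots> \<le> 1 / \<bar>\<mu>\<bar> + 1 / \<bar>\<mu>\<bar>"
      by (rule order_trans[OF norm_triangle_ineq4]) (simp add: norm_divide norm_mult)
    finally have "norm (integral {- T..T} (\<lambda>t. cis (\<mu> * t))) \<le> 2 / \<bar>\<mu>\<bar>"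
      by simp
    then have "1 / (2 * T) * norm (integral {- T..T} (\<lambda>t. cis (\<mu> * t))) \<le> 1 / (2 * T) * (2 / \<bar>\<mu>\<bar>)"
      using that by (intro mult_left_mono) auto
    moreover have "norm (complex_of_real (1 / (2 * T))) = 1 / (2 * T)"
      using that by (simp only: norm_of_real) simp
    ultimately show ?thesis by (simp only: norm_mult) (simp add: mult.commute)
  qed
  then have "\<forall>\<^sub>F T in at_top. norm (complex_of_real (1 / (2 * T)) *
      integral {- T..T} (\<lambda>t. cis (\<mu> * t))) \<le> 1 / (\<bar>\<mu>\<bar> * T)"
    by (rule eventually_mono[OF eventually_gt_at_top])
  moreover have "((\<lambda>T. 1 / (\<bar>\<mu>\<bar> * T)) \<longlongrightarrow> 0) at_top"
  proof (rule tendsto_divide_0[OF tendsto_const filterlim_at_top_imp_at_infinity])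
    show "filterlim (\<lambda>T. \<bar>\<mu>\<bar> * T) at_top at_top"
      by (rule filterlim_tendsto_pos_mult_at_top[OF tendsto_const _ filterlim_ident])
        (use False in simp)
  qed
  ultimately have "has_mean (\<lambda>t. cis (\<mu> * t)) 0"
    unfolding has_mean_def by (rule Lim_null_comparison)
  then show ?thesis using False by simp
qed (use has_mean_const[of 1] in simp)

text \<open>The majorant is a function with a mean of its own. This freedom serves the moment
  estimate in \<open>trig_sum_le_of_approx\<close> and the kernel estimate in
  \<open>bf_op_approx\<close>.\<close>

lemma has_mean_bound:
  assumes h: "continuous_on UNIV h" "has_mean h c"
    and w: "continuous_on UNIV w" "has_mean (\<lambda>t. complex_of_real (w t)) (complex_of_real W)"
    and le: "\<And>t. norm (h t) \<le> w t"
  shows "norm c \<le> W"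
proof -
  have c: "((\<lambda>T. norm (complex_of_real (1 / (2 * T)) * integral {- T..T} h)) \<longlongrightarrow> norm c) at_top"
    using h(2) unfolding has_mean_def by (rule tendsto_norm)
  have W: "((\<lambda>T. Re (complex_of_real (1 / (2 * T)) * integral {- T..T} (\<lambda>t. complex_of_real (w t))))
      \<longlongrightarrow> W) at_top"
    using tendsto_Re[OF w(2)[unfolded has_mean_def]] by simp
  show ?thesis
  proof (rule tendsto_le[OF _ W c], simp, rule eventually_mono[OF eventually_gt_at_top[of 0]])
    fix T :: real assume T: "T > 0"
    have w_int: "w integrable_on {- T..T}" and h_int: "h integrable_on {- T..T}"
      by (intro integrable_continuous_interval; use h w continuous_on_subset in blast)+
    have "norm (integral {- T..T} h) \<le> integral {- T..T} w"
      by (rule integral_norm_bound_integral[OF h_int w_int le])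
    moreover have "integral {- T..T} (\<lambda>t. complex_of_real (w t)) = complex_of_real (integral {- T..T} w)"
      by (rule integral_unique)
        (use has_integral_of_real[OF integrable_integral[OF w_int]] in simp)
    ultimately show "norm (complex_of_real (1 / (2 * T)) * integral {- T..T} h) \<le>
        Re (complex_of_real (1 / (2 * T)) * integral {- T..T} (\<lambda>t. complex_of_real (w t)))"
      using T by (simp add: norm_mult norm_divide divide_right_mono)
  qed
qed

lemma has_mean_bound_const:
  assumes "continuous_on UNIV h" "has_mean h c" "\<And>t. norm (h t) \<le> b"
  shows "norm c \<le> b"
  by (rule has_mean_bound[OF assms(1,2) _ has_mean_const assms(3)]) simp

text \<open>An interchange of limits: replacing \<open>h\<close> by \<open>p n\<close> changes the
  average over every interval by at most the sup distance, uniformly in T.\<close>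

lemma has_mean_uniform_limit:
  assumes p: "\<And>n. continuous_on UNIV (p n)" "\<And>n. has_mean (p n) (c n)"
    and u: "uniform_limit UNIV p h sequentially" and c: "c \<longlonglongrightarrow> d"
  shows "has_mean h d"
  unfolding has_mean_def
proof (rule tendstoI)
  fix e :: real assume "e > 0"
  have hc: "continuous_on UNIV h"
    by (rule uniform_limit_theorem[OF _ u]) (use p in auto)
  have "\<forall>\<^sub>F n in sequentially. (\<forall>t\<in>UNIV. dist (p n t) (h t) < e / 3) \<and> dist (c n) d < e / 3"
    using uniform_limitD[OF u, of "e / 3"] tendstoD[OF c, of "e / 3"] \<open>e > 0\<close>
    by (intro eventually_conj) auto
  then obtain n where n: "\<And>t. dist (p n t) (h t) < e / 3" "dist (c n) d < e / 3"
    by (auto simp: eventually_sequentially)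
  have "\<forall>\<^sub>F T in at_top. dist (complex_of_real (1 / (2 * T)) * integral {- T..T} (p n)) (c n) < e / 3"
    using tendstoD[OF p(2)[of n, unfolded has_mean_def], of "e / 3"] \<open>e > 0\<close> by simp
  then show "\<forall>\<^sub>F T in at_top. dist (complex_of_real (1 / (2 * T)) * integral {- T..T} h) d < e"
    using eventually_gt_at_top[of 0]
  proof eventually_elim
    fix T :: real
    assume T: "dist (complex_of_real (1 / (2 * T)) * integral {- T..T} (p n)) (c n) < e / 3" "0 < T"
    have int: "h integrable_on {- T..T}" "p n integrable_on {- T..T}"
      by (intro integrable_continuous_interval; use hc p(1) continuous_on_subset in blast)+
    have "norm (integral {- T..T} (\<lambda>t. h t - p n t)) \<le> e / 3 * (T - (- T))"
    proof (rule integral_bound)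
      show "continuous_on {- T..T} (\<lambda>t. h t - p n t)"
        by (rule continuous_on_subset[OF continuous_on_diff[OF hc p(1)]]) simp
      show "norm (h t - p n t) \<le> e / 3" for t
        using n(1)[of t] by (simp add: dist_norm norm_minus_commute)
    qed (use T in simp)
    then have "dist (complex_of_real (1 / (2 * T)) * integral {- T..T} h)
        (complex_of_real (1 / (2 * T)) * integral {- T..T} (p n)) \<le> e / 3"
      using T by (simp add: dist_norm norm_mult integral_diff[OF int]
          right_diff_distrib[symmetric] norm_divide field_simps)
    then show "dist (complex_of_real (1 / (2 * T)) * integral {- T..T} h) d < e"
      using T(1) n(2) dist_triangle[of "complex_of_real (1 / (2 * T)) * integral {- T..T} h" d "c n"]
        dist_triangle[of "complex_of_real (1 / (2 * T)) * integral {- T..T} h" "c n"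
          "complex_of_real (1 / (2 * T)) * integral {- T..T} (p n)"]
      by linarith
  qed
qed

text \<open>Taking means does not increase sup distances, so the means of approximants with error 1
  / (n + 1) form a Cauchy sequence.\<close>

lemma has_mean_exists:
  assumes "\<And>e. e > 0 \<Longrightarrow> \<exists>p c. continuous_on UNIV p \<and> has_mean p c \<and> (\<forall>t. norm (h t - p t) \<le> e)"
  shows "\<exists>c. has_mean h c"
proof -
  have "\<forall>n. \<exists>p c. continuous_on UNIV p \<and> has_mean p c \<and> (\<forall>t. norm (h t - p t) \<le> inverse (Suc n))"
    using assms by simp
  then obtain p c where p: "\<And>n. continuous_on UNIV (p n)" "\<And>n. has_mean (p n) (c n)"
      "\<And>n t. norm (h t - p n t) \<le> inverse (Suc n)"
    by metis
  have u: "uniform_limit UNIV p h sequentially"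
  proof (rule uniform_limitI)
    fix e :: real assume "e > 0"
    have "\<forall>\<^sub>F n in sequentially. inverse (real (Suc n)) < e"
      using LIMSEQ_inverse_real_of_nat \<open>e > 0\<close> by (rule order_tendstoD)
    then show "\<forall>\<^sub>F n in sequentially. \<forall>t\<in>UNIV. dist (p n t) (h t) < e"
    proof eventually_elim
      fix n assume "inverse (real (Suc n)) < e"
      then show "\<forall>t\<in>UNIV. dist (p n t) (h t) < e"
        using p(3)[of _ n] by (metis dist_commute dist_norm order_le_less_trans)
    qed
  qed
  have "Cauchy c"
  proof (rule metric_CauchyI)
    fix e :: real assume "e > 0"
    then obtain M where M: "inverse (real (Suc M)) < e / 2"
      using reals_Archimedean[of "e / 2"] by auto
    have "dist (c m) (c n) < e" if "m \<ge> M" "n \<ge> M" for m n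
    proof -
      have "norm (c m - c n) \<le> inverse (real (Suc M)) + inverse (real (Suc M))"
      proof (rule has_mean_bound_const[OF _ has_mean_diff[OF p(1) p(1) p(2) p(2)]])
        fix t
        have "norm (p m t - p n t) \<le> norm (h t - p n t) + norm (h t - p m t)"
          using norm_triangle_ineq4[of "h t - p n t" "h t - p m t"] by simp
        also have "\<dots> \<le> inverse (real (Suc n)) + inverse (real (Suc m))"
          by (intro add_mono p)
        also have "\<dots> \<le> inverse (real (Suc M)) + inverse (real (Suc M))"
          using that by (intro add_mono le_imp_inverse_le) auto
        finally show "norm (p m t - p n t) \<le> inverse (real (Suc M)) + inverse (real (Suc M))" .
      qed (intro continuous_intros p)
      then show ?thesis using M by (simp add: dist_norm)
    qed
    then show "\<exists>M. \<forall>m\<ge>M. \<forall>n\<ge>M. dist (c m) (c n) < e" by blast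
  qed
  then obtain d where "c \<longlonglongrightarrow> d" by (auto simp: Cauchy_convergent_iff convergent_def)
  then show ?thesis using has_mean_uniform_limit[OF p(1,2) u] by blast
qed

section \<open>Uniqueness for almost periodic functions of a real variable\<close>

text \<open>Indexing by a set of frequencies keeps them distinct, so \<open>c\<close> is exactly the
  family of Fourier coefficients and Parseval has no cross terms.\<close>

definition trig_sum :: "real set \<Rightarrow> (real \<Rightarrow> complex) \<Rightarrow> real \<Rightarrow> complex" where
  "trig_sum S c t = (\<Sum>\<mu>\<in>S. c \<mu> * cis (\<mu> * t))"

lemma continuous_on_cis_mult [continuous_intros]: "continuous_on A (\<lambda>t. cis (\<mu> * t))"
  by (intro continuous_intros)

lemma continuous_on_trig_sum [continuous_intros]: "continuous_on A (trig_sum S c)"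
  unfolding trig_sum_def[abs_def] by (intro continuous_intros)

lemma has_mean_trig_sum_cis:
  assumes "finite S"
  shows "has_mean (\<lambda>t. trig_sum S c t * cis (\<nu> * t)) (if - \<nu> \<in> S then c (- \<nu>) else 0)"
proof -
  have "has_mean (\<lambda>t. \<Sum>\<mu>\<in>S. c \<mu> * cis ((\<mu> + \<nu>) * t))
      (\<Sum>\<mu>\<in>S. c \<mu> * (if \<mu> + \<nu> = 0 then 1 else 0))"
    by (intro has_mean_sum assms has_mean_cmult has_mean_cis continuous_intros)
  moreover have "(\<Sum>\<mu>\<in>S. c \<mu> * (if \<mu> + \<nu> = 0 then 1 else 0)) = (\<Sum>\<mu>\<in>S. if \<mu> = - \<nu> then c \<mu> else 0)"
    by (intro sum.cong) auto
  ultimately show ?thesis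
    using assms by (simp add: trig_sum_def sum_distrib_right mult.assoc cis_mult distrib_right sum.delta)
qed

text \<open>Terms with equal frequency are merged, which brings an arbitrary finite exponential sum
  into the form with distinct frequencies.\<close>

lemma sum_cis_eq_trig_sum:
  assumes "finite I"
  shows "(\<Sum>i\<in>I. a i * cis (\<phi> i * t)) = trig_sum (\<phi> ` I) (\<lambda>\<mu>. \<Sum>i | i \<in> I \<and> \<phi> i = \<mu>. a i) t"
  by (simp add: sum.image_gen[OF assms, of _ \<phi>] trig_sum_def sum_distrib_right)

lemma trig_sum_superset:
  assumes "finite S'" "S \<subseteq> S'"
  shows "trig_sum S c t = trig_sum S' (\<lambda>\<mu>. if \<mu> \<in> S then c \<mu> else 0) t"
  unfolding trig_sum_def by (intro sum.mono_neutral_cong_left) (use assms in auto)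

lemma trig_sum_mult:
  assumes "finite S" "finite S'"
  shows "\<exists>c''. \<forall>t. trig_sum S c t * trig_sum S' c' t = trig_sum ((\<lambda>(\<mu>, \<nu>). \<mu> + \<nu>) ` (S \<times> S')) c'' t"
proof -
  have "trig_sum S c t * trig_sum S' c' t =
      (\<Sum>i\<in>S \<times> S'. (c (fst i) * c' (snd i)) * cis ((case i of (\<mu>, \<nu>) \<Rightarrow> \<mu> + \<nu>) * t))" for t
    by (simp add: trig_sum_def sum_product sum.cartesian_product distrib_left cis_mult
        case_prod_unfold mult_ac)
  then have "trig_sum S c t * trig_sum S' c' t = trig_sum ((\<lambda>(\<mu>, \<nu>). \<mu> + \<nu>) ` (S \<times> S'))
      (\<lambda>\<kappa>. \<Sum>i | i \<in> S \<times> S' \<and> (case i of (\<mu>, \<nu>) \<Rightarrow> \<mu> + \<nu>) = \<kappa>. c (fst i) * c' (snd i)) t" for t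
    using sum_cis_eq_trig_sum[of "S \<times> S'"] assms by simp
  then show ?thesis by blast
qed

definition trig_poly :: "(real \<Rightarrow> complex) \<Rightarrow> bool" where
  "trig_poly p \<longleftrightarrow> (\<exists>S c. finite S \<and> (\<forall>t. p t = trig_sum S c t))"

lemma trig_poly_trig_sum: "finite S \<Longrightarrow> trig_poly (trig_sum S c)"
  by (auto simp: trig_poly_def)

lemma trig_poly_mult: "trig_poly p \<Longrightarrow> trig_poly q \<Longrightarrow> trig_poly (\<lambda>t. p t * q t)"
proof -
  assume "trig_poly p" "trig_poly q"
  then obtain S c S' c' where p: "finite S" "\<And>t. p t = trig_sum S c t" and q: "finite S'" "\<And>t. q t = trig_sum S' c' t"
    by (auto simp: trig_poly_def)
  from trig_sum_mult[OF p(1) q(1), of c c'] obtain c'' where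
    "\<forall>t. trig_sum S c t * trig_sum S' c' t = trig_sum ((\<lambda>(\<mu>, \<nu>). \<mu> + \<nu>) ` (S \<times> S')) c'' t" ..
  moreover have "finite ((\<lambda>(\<mu>, \<nu>). \<mu> + \<nu>) ` (S \<times> S'))" using p(1) q(1) by simp
  ultimately show ?thesis
    unfolding trig_poly_def p(2) q(2) by (intro exI conjI)
qed

lemma trig_poly_cnj:
  assumes "trig_poly p"
  shows "trig_poly (\<lambda>t. cnj (p t))"
proof -
  obtain S c where S: "finite S" "\<And>t. p t = trig_sum S c t"
    using assms by (auto simp: trig_poly_def)
  have "cnj (p t) = (\<Sum>\<mu>\<in>S. cnj (c \<mu>) * cis (- \<mu> * t))" for t
    by (simp add: S trig_sum_def cis_cnj)
  then have "cnj (p t) = trig_sum (uminus ` S) (\<lambda>\<kappa>. \<Sum>\<mu> | \<mu> \<in> S \<and> - \<mu> = \<kappa>. cnj (c \<mu>)) t" for t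
    by (simp only: sum_cis_eq_trig_sum[OF S(1)])
  then show ?thesis
    unfolding trig_poly_def using S(1) by blast
qed

text \<open>Every frequency of the n-th power is a combination of the elements of \<open>S\<close>
  with multiplicities between 0 and n. With \<open>S\<close> fixed, their number is polynomial in
  n.\<close>

lemma trig_sum_power:
  assumes "finite S"
  shows "\<exists>S' c'. finite S' \<and> card S' \<le> (n + 1) ^ card S \<and> (\<forall>t. trig_sum S c t ^ n = trig_sum S' c' t)"
proof -
  \<comment> \<open>The multiplicities are only bounded by n instead of summing to n. This larger
    set is the image of a product of intervals and is counted at once.\<close>
  define R where "R n = (\<lambda>\<phi>. \<Sum>\<mu>\<in>S. real (\<phi> \<mu>) * \<mu>) ` (S \<rightarrow>\<^sub>E {..n})" for n :: nat
  have fin: "finite (R n)" for n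
    unfolding R_def using assms by (intro finite_imageI finite_PiE) auto
  have "\<exists>c'. \<forall>t. trig_sum S c t ^ n = trig_sum (R n) c' t"
  proof (induction n)
    case 0
    have "0 \<in> R 0"
      unfolding R_def by (rule image_eqI[of _ _ "\<lambda>\<mu>\<in>S. 0"]) auto
    then have "trig_sum {0} (\<lambda>_. 1) t = trig_sum (R 0) (\<lambda>\<mu>. if \<mu> \<in> {0} then 1 else 0) t" for t
      by (intro trig_sum_superset fin) simp
    moreover have "trig_sum {0} (\<lambda>_. 1) t = 1" for t by (simp add: trig_sum_def)
    ultimately show ?case by auto
  next
    case (Suc n)
    then obtain c' where c': "\<And>t. trig_sum S c t ^ n = trig_sum (R n) c' t" by blast
    obtain c'' where c'': "\<And>t. trig_sum S c t * trig_sum (R n) c' t = trig_sum ((\<lambda>(\<mu>, \<nu>). \<mu> + \<nu>) ` (S \<times> R n)) c'' t"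
      using trig_sum_mult[OF assms fin] by blast
    have "(\<lambda>(\<mu>, \<nu>). \<mu> + \<nu>) ` (S \<times> R n) \<subseteq> R (Suc n)"
    proof clarify
      fix \<mu> \<nu> assume "\<mu> \<in> S" "\<nu> \<in> R n"
      then obtain \<phi> where \<phi>: "\<phi> \<in> S \<rightarrow>\<^sub>E {..n}" "\<nu> = (\<Sum>\<mu>\<in>S. real (\<phi> \<mu>) * \<mu>)"
        by (auto simp: R_def)
      have "\<mu> + \<nu> = (\<Sum>\<kappa>\<in>S. real ((\<phi>(\<mu> := Suc (\<phi> \<mu>))) \<kappa>) * \<kappa>)"
        using \<open>\<mu> \<in> S\<close> assms by (simp add: \<phi>(2) sum.remove[of S \<mu>] distrib_right)
      moreover have "\<phi>(\<mu> := Suc (\<phi> \<mu>)) \<in> S \<rightarrow>\<^sub>E {..Suc n}"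
        using \<phi>(1) \<open>\<mu> \<in> S\<close> by (fastforce simp: PiE_iff extensional_def intro: le_SucI)
      ultimately show "\<mu> + \<nu> \<in> R (Suc n)" unfolding R_def by (rule image_eqI)
    qed
    then show ?case
      using trig_sum_superset[OF fin, of _ _ c''] by (auto simp: c' c'')
  qed
  moreover have "card (R n) \<le> (n + 1) ^ card S"
    unfolding R_def using card_image_le[of "S \<rightarrow>\<^sub>E {..n}"] assms
    by (simp add: card_PiE finite_PiE)
  ultimately show ?thesis using fin by blast
qed

text \<open>Parseval: after expanding only the conjugated factor, each term is a mean that reads off
  one coefficient of the other factor.\<close>

lemma has_mean_trig_sum_norm_sq:
  assumes "finite S"
  shows "has_mean (\<lambda>t. complex_of_real ((cmod (trig_sum S c t))\<^sup>2)) (complex_of_real (\<Sum>\<mu>\<in>S. (cmod (c \<mu>))\<^sup>2))"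
proof -
  have "has_mean (\<lambda>t. \<Sum>\<nu>\<in>S. cnj (c \<nu>) * (trig_sum S c t * cis (- \<nu> * t)))
      (\<Sum>\<nu>\<in>S. cnj (c \<nu>) * (if - (- \<nu>) \<in> S then c (- (- \<nu>)) else 0))"
    by (intro has_mean_sum has_mean_cmult has_mean_trig_sum_cis continuous_intros assms)
  moreover have "(\<Sum>\<nu>\<in>S. cnj (c \<nu>) * (if - (- \<nu>) \<in> S then c (- (- \<nu>)) else 0)) =
      complex_of_real (\<Sum>\<mu>\<in>S. (cmod (c \<mu>))\<^sup>2)"
    by (simp add: complex_norm_square mult.commute del: of_real_power)
  moreover have "(\<Sum>\<nu>\<in>S. cnj (c \<nu>) * (trig_sum S c t * cis (- \<nu> * t))) = complex_of_real ((cmod (trig_sum S c t))\<^sup>2)" for t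
  proof -
    have "cnj (trig_sum S c t) = (\<Sum>\<nu>\<in>S. cnj (c \<nu>) * cis (- \<nu> * t))"
      by (simp add: trig_sum_def cis_cnj)
    then show ?thesis
      by (simp add: complex_norm_square sum_distrib_left mult_ac del: of_real_power)
  qed
  ultimately show ?thesis by simp
qed

text \<open>Cauchy-Schwarz against the constant 1. It turns a bound in mean square into a pointwise
  one at the cost of the number of frequencies.\<close>

lemma trig_sum_norm_sq_le: "(cmod (trig_sum S c t))\<^sup>2 \<le> card S * (\<Sum>\<mu>\<in>S. (cmod (c \<mu>))\<^sup>2)"
proof -
  have "cmod (trig_sum S c t) \<le> (\<Sum>\<mu>\<in>S. 1 * cmod (c \<mu>))"
    unfolding trig_sum_def by (rule order_trans[OF norm_sum]) (simp add: norm_mult)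
  then have "(cmod (trig_sum S c t))\<^sup>2 \<le> (\<Sum>\<mu>\<in>S. 1 * cmod (c \<mu>))\<^sup>2"
    by (intro power_mono) auto
  also have "\<dots> \<le> (\<Sum>\<mu>\<in>S. 1\<^sup>2) * (\<Sum>\<mu>\<in>S. (cmod (c \<mu>))\<^sup>2)"
    by (rule Cauchy_Schwarz_ineq_sum)
  finally show ?thesis by simp
qed

text \<open>If x were larger than e, the powers of (x / e)^2 would grow exponentially and overtake
  the polynomial factor.\<close>

lemma power_le_poly_times_power_imp_le:
  fixes x e :: real
  assumes "e > 0" and le: "\<And>n. x ^ (2 * n) \<le> (real n + 1) ^ m * e ^ (2 * n)"
  shows "x \<le> e"
proof (rule ccontr)
  assume "\<not> x \<le> e"
  define q where "q = (x / e)\<^sup>2"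
  \<comment> \<open>The root reduces degree m to linear growth. Its order is m + 1 so that it is a
    genuine root also for m = 0.\<close>
  define y where "y = root (Suc m) q"
  have "q > 1" using \<open>\<not> x \<le> e\<close> \<open>e > 0\<close> by (simp add: q_def)
  then have y: "y > 1" "y ^ Suc m = q"
    by (auto simp: y_def simp del: power_Suc)
  have "y ^ n \<le> real n + 1" for n
  proof -
    have "(y ^ n) ^ Suc m = q ^ n"
      by (metis y(2) power_mult mult.commute)
    also have "\<dots> = x ^ (2 * n) / e ^ (2 * n)"
      by (simp add: q_def power_mult[symmetric] power_divide)
    also have "\<dots> \<le> (real n + 1) ^ m"
      using le[of n] \<open>e > 0\<close> by (simp add: divide_le_eq)
    also have "\<dots> \<le> (real n + 1) ^ Suc m"
      by (intro power_increasing) auto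
    finally show ?thesis
      by (rule power_le_imp_le_base) simp
  qed
  moreover have "(\<lambda>n. real n * (1 / y) ^ n + (1 / y) ^ n) \<longlonglongrightarrow> 0 + 0"
    using y by (intro tendsto_add powser_times_n_limit_0 LIMSEQ_power_zero) auto
  then have "\<forall>\<^sub>F n in sequentially. real n * (1 / y) ^ n + (1 / y) ^ n < 1"
    by (rule order_tendstoD) simp
  then obtain n where "real n * (1 / y) ^ n + (1 / y) ^ n < 1"
    by (auto simp: eventually_sequentially)
  then have "real n + 1 < y ^ n"
    using y by (simp add: power_divide field_simps)
  ultimately show False by (meson not_le)
qed

section \<open>Almost periodic functions on the real line and their uniqueness theorem\<close>

definition almost_periodic :: "(real \<Rightarrow> complex) \<Rightarrow> bool" where
  "almost_periodic h \<longleftrightarrow> (\<forall>e>0. \<exists>S c. finite S \<and> (\<forall>t. cmod (h t - trig_sum S c t) \<le> e))"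

lemma almost_periodic_trig_sum:
  assumes "finite S"
  shows "almost_periodic (trig_sum S c)"
proof -
  have "cmod (trig_sum S c t - trig_sum S c t) \<le> e" if "e > 0" for t e using that by simp
  then show ?thesis unfolding almost_periodic_def using assms by blast
qed

lemma almost_periodic_uniform_limit:
  assumes "\<And>n. almost_periodic (p n)" "uniform_limit UNIV p h sequentially"
  shows "almost_periodic h"
  unfolding almost_periodic_def
proof safe
  fix e :: real assume "e > 0"
  then have "\<forall>\<^sub>F n in sequentially. \<forall>t\<in>UNIV. dist (p n t) (h t) < e / 2"
    using uniform_limitD[OF assms(2), of "e / 2"] by simp
  then obtain n where n: "\<And>t. dist (p n t) (h t) < e / 2"
    by (auto simp: eventually_sequentially)
  obtain S c where S: "finite S" "\<And>t. cmod (p n t - trig_sum S c t) \<le> e / 2"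
    using assms(1)[of n] \<open>e > 0\<close> unfolding almost_periodic_def by (meson half_gt_zero)
  have "cmod (h t - trig_sum S c t) \<le> e" for t
    using norm_triangle_ineq[of "h t - p n t" "p n t - trig_sum S c t"] n[of t] S(2)[of t]
    by (simp add: dist_norm norm_minus_commute)
  then show "\<exists>S c. finite S \<and> (\<forall>t. cmod (h t - trig_sum S c t) \<le> e)" using S(1) by blast
qed

lemma almost_periodic_diff:
  assumes "almost_periodic h" "almost_periodic k"
  shows "almost_periodic (\<lambda>t. h t - k t)"
  unfolding almost_periodic_def
proof safe
  fix e :: real assume "e > 0"
  obtain S c where S: "finite S" "\<And>t. cmod (h t - trig_sum S c t) \<le> e / 2"
    using assms(1) \<open>e > 0\<close> unfolding almost_periodic_def by (meson half_gt_zero)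
  obtain R b where R: "finite R" "\<And>t. cmod (k t - trig_sum R b t) \<le> e / 2"
    using assms(2) \<open>e > 0\<close> unfolding almost_periodic_def by (meson half_gt_zero)
  define d where "d \<mu> = (if \<mu> \<in> S then c \<mu> else 0) - (if \<mu> \<in> R then b \<mu> else 0)" for \<mu>
  have "trig_sum S c t - trig_sum R b t = trig_sum (S \<union> R) d t" for t
    using trig_sum_superset[of "S \<union> R" S c t] trig_sum_superset[of "S \<union> R" R b t] S(1) R(1)
    by (simp add: trig_sum_def d_def left_diff_distrib sum_subtractf)
  then have "cmod (h t - k t - trig_sum (S \<union> R) d t) \<le> e" for t
    using norm_triangle_ineq4[of "h t - trig_sum S c t" "k t - trig_sum R b t"] S(2)[of t] R(2)[of t]
    by (simp add: algebra_simps)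
  then show "\<exists>S c. finite S \<and> (\<forall>t. cmod (h t - k t - trig_sum S c t) \<le> e)"
    using S(1) R(1) by (metis finite_UnI)
qed

lemma almost_periodic_obtain_seq:
  assumes "almost_periodic h"
  obtains S c where "\<And>n. finite (S n)" "uniform_limit UNIV (\<lambda>n. trig_sum (S n) (c n)) h sequentially"
proof -
  have "\<forall>n. \<exists>S c. finite S \<and> (\<forall>t. cmod (h t - trig_sum S c t) \<le> inverse (Suc n))"
    using assms by (simp add: almost_periodic_def)
  then obtain S c where S: "\<And>n. finite (S n)" "\<And>n t. cmod (h t - trig_sum (S n) (c n) t) \<le> inverse (Suc n)"
    by metis
  have "uniform_limit UNIV (\<lambda>n. trig_sum (S n) (c n)) h sequentially"
  proof (rule uniform_limitI)
    fix e :: real assume "e > 0"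
    have "\<forall>\<^sub>F n in sequentially. inverse (real (Suc n)) < e"
      using LIMSEQ_inverse_real_of_nat \<open>e > 0\<close> by (rule order_tendstoD)
    then show "\<forall>\<^sub>F n in sequentially. \<forall>t\<in>UNIV. dist (trig_sum (S n) (c n) t) (h t) < e"
    proof eventually_elim
      fix n assume "inverse (real (Suc n)) < e"
      then show "\<forall>t\<in>UNIV. dist (trig_sum (S n) (c n) t) (h t) < e"
        using S(2)[of _ n] by (metis dist_commute dist_norm order_le_less_trans)
    qed
  qed
  then show ?thesis using that S(1) by blast
qed

lemma almost_periodic_continuous:
  assumes "almost_periodic h"
  shows "continuous_on UNIV h"
proof -
  obtain S c where "\<And>n. finite (S n)" "uniform_limit UNIV (\<lambda>n. trig_sum (S n) (c n)) h sequentially"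
    using almost_periodic_obtain_seq[OF assms] by metis
  then show ?thesis
    by (intro uniform_limit_theorem[where F = sequentially]) (simp_all add: continuous_on_trig_sum)
qed

lemma has_mean_mult_trig_poly:
  assumes "continuous_on UNIV h" "\<And>\<mu>. has_mean (\<lambda>t. h t * cis (\<mu> * t)) 0" "trig_poly q"
  shows "has_mean (\<lambda>t. h t * q t) 0"
proof -
  obtain S c where S: "finite S" "\<And>t. q t = trig_sum S c t"
    using assms(3) by (auto simp: trig_poly_def)
  have "has_mean (\<lambda>t. \<Sum>\<mu>\<in>S. c \<mu> * (h t * cis (\<mu> * t))) (\<Sum>\<mu>\<in>S. c \<mu> * 0)"
    by (intro has_mean_sum has_mean_cmult continuous_intros assms S)
  then show ?thesis
    by (simp add: S(2) trig_sum_def sum_distrib_left mult_ac)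
qed

lemma trig_sum_le_of_approx:
  assumes h: "continuous_on UNIV h" "\<And>\<mu>. has_mean (\<lambda>t. h t * cis (\<mu> * t)) 0"
    and S: "finite S" and e: "e > 0" "\<And>t. cmod (h t - trig_sum S c t) \<le> e"
  shows "cmod (trig_sum S c t) \<le> e"
proof -
  define p where "p = trig_sum S c"
  obtain R a where R: "\<And>n. finite (R n)" "\<And>n. card (R n) \<le> (n + 1) ^ card S"
      "\<And>n t. p t ^ n = trig_sum (R n) (a n) t"
    using trig_sum_power[OF S, of _ c] unfolding p_def by metis
  define A where "A n = (\<Sum>\<mu>\<in>R n. (cmod (a n \<mu>))\<^sup>2)" for n
  \<comment> \<open>Parseval for \<open>p^n\<close>: the sum of squared coefficients
    \<open>A n\<close> is the moment of order 2n of |p|.\<close>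
  have meanA: "has_mean (\<lambda>t. complex_of_real (cmod (p t) ^ (2 * n))) (complex_of_real (A n))" for n
    using has_mean_trig_sum_norm_sq[OF R(1), of n "a n"]
    by (simp add: A_def R(3)[symmetric] norm_power power_mult mult.commute[of 2])
  have cont: "continuous_on UNIV p" by (simp add: p_def continuous_on_trig_sum)
  have step: "A (Suc n) \<le> e\<^sup>2 * A n" for n
  proof -
    \<comment> \<open>This is cnj p |p|^(2n), written as a product of trigonometric polynomials so
      that \<open>h\<close> is orthogonal to it. Hence \<open>A (Suc n)\<close>, the mean of p q, is
      also the mean of (p - h) q.\<close>
    define q where "q t = cnj (p t * trig_sum (R n) (a n) t) * trig_sum (R n) (a n) t" for t
    have q: "q t = cnj (p t ^ Suc n) * p t ^ n" for t
      by (simp add: q_def R(3))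
    have "trig_poly q"
      unfolding q_def p_def by (intro trig_poly_mult trig_poly_cnj trig_poly_trig_sum S R)
    then have hq: "has_mean (\<lambda>t. h t * q t) 0" by (rule has_mean_mult_trig_poly[OF h])
    have qc: "continuous_on UNIV q" unfolding q by (intro continuous_intros cont)
    have norm_q: "cmod (q t) = cmod (p t) ^ n * cmod (p t) ^ Suc n" for t
      by (simp add: q norm_mult norm_power)
    have pq: "p t * q t = complex_of_real (cmod (p t) ^ (2 * Suc n))" for t
    proof -
      have "p t * q t = p t ^ Suc n * cnj (p t ^ Suc n)"
        by (simp add: q mult_ac)
      also have "\<dots> = complex_of_real ((cmod (p t ^ Suc n))\<^sup>2)"
        by (rule complex_norm_square[symmetric])
      also have "(cmod (p t ^ Suc n))\<^sup>2 = cmod (p t) ^ (2 * Suc n)"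
        by (metis norm_power power_mult mult.commute)
      finally show ?thesis .
    qed
    have "cmod (complex_of_real (A (Suc n)) - 0) \<le> (e\<^sup>2 * A n + A (Suc n)) / 2"
    proof (rule has_mean_bound)
      show "has_mean (\<lambda>t. p t * q t - h t * q t) (complex_of_real (A (Suc n)) - 0)"
        using has_mean_diff[OF continuous_on_mult[OF cont qc] continuous_on_mult[OF h(1) qc] _ hq]
          meanA[of "Suc n"] by (simp only: pq)
      show "continuous_on UNIV (\<lambda>t. p t * q t - h t * q t)"
        by (intro continuous_intros cont qc h)
      \<comment> \<open>The bound e |p|^(2n+1) has odd degree. The inequality 2ab \<le> a^2 + b^2
        splits it into two even moments, and the half of \<open>A (Suc n)\<close> that arises is
        absorbed on the left.\<close>
      let ?w = "\<lambda>t. (e\<^sup>2 * cmod (p t) ^ (2 * n) + cmod (p t) ^ (2 * Suc n)) / 2"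
      show "continuous_on UNIV ?w" by (intro continuous_intros cont) simp
      have "has_mean (\<lambda>t. complex_of_real (1/2) * (complex_of_real (e\<^sup>2) * complex_of_real (cmod (p t) ^ (2 * n)) +
          complex_of_real (cmod (p t) ^ (2 * Suc n))))
          (complex_of_real (1/2) * (complex_of_real (e\<^sup>2) * complex_of_real (A n) + complex_of_real (A (Suc n))))"
        by (intro has_mean_cmult has_mean_add meanA continuous_intros cont)
      then show "has_mean (\<lambda>t. complex_of_real (?w t)) (complex_of_real ((e\<^sup>2 * A n + A (Suc n)) / 2))"
        by simp
      show "cmod (p t * q t - h t * q t) \<le> ?w t" for t
      proof -
        have "cmod (p t * q t - h t * q t) \<le> e * cmod (q t)"
          using e(2)[of t] by (simp add: left_diff_distrib[symmetric] norm_mult norm_minus_commute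
              mult_right_mono p_def)
        also have "\<dots> = (e * cmod (p t) ^ n) * cmod (p t) ^ Suc n" by (simp add: norm_q)
        also have "\<dots> \<le> ((e * cmod (p t) ^ n)\<^sup>2 + (cmod (p t) ^ Suc n)\<^sup>2) / 2"
          using sum_squares_bound[of "e * cmod (p t) ^ n" "cmod (p t) ^ Suc n"] by simp
        also have "\<dots> = ?w t"
          by (simp only: power_mult_distrib power_mult[symmetric] mult.commute[of 2])
        finally show ?thesis .
      qed
    qed
    then show ?thesis by simp
  qed
  have A0: "A 0 = 1"
    using has_mean_unique[OF _ has_mean_const[of 1]] meanA[of 0] by fastforce
  have An: "A n \<le> e ^ (2 * n)" for n
  proof (induction n)
    case (Suc n)
    have "A (Suc n) \<le> e\<^sup>2 * e ^ (2 * n)"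
      using step[of n] mult_left_mono[OF Suc, of "e\<^sup>2"] by simp
    then show ?case by (simp add: power2_eq_square mult.assoc)
  qed (simp add: A0)
  have "cmod (p t) \<le> e"
  proof (rule power_le_poly_times_power_imp_le[OF e(1)])
    fix n
    have "cmod (p t) ^ (2 * n) = (cmod (trig_sum (R n) (a n) t))\<^sup>2"
      by (simp add: R(3)[symmetric] norm_power power_mult[symmetric] mult.commute)
    also have "\<dots> \<le> card (R n) * A n"
      unfolding A_def by (rule trig_sum_norm_sq_le)
    also have "\<dots> \<le> real ((n + 1) ^ card S) * e ^ (2 * n)"
      using An R(2)[of n] by (intro mult_mono of_nat_mono) (auto simp: A_def intro: sum_nonneg)
    finally show "cmod (p t) ^ (2 * n) \<le> (real n + 1) ^ card S * e ^ (2 * n)"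
      by (simp add: add.commute)
  qed
  then show ?thesis by (simp add: p_def)
qed

text \<open>An approximating sum at distance e / 2 from \<open>h\<close> has itself size at most e /
  2, so |h| is at most e for every positive e.\<close>

lemma almost_periodic_eq_0:
  assumes "almost_periodic h" "\<And>\<mu>. has_mean (\<lambda>t. h t * cis (\<mu> * t)) 0"
  shows "h t = 0"
proof -
  have "cmod (h t) \<le> 0 + e" if "e > 0" for e
  proof -
    obtain S c where S: "finite S" "\<And>t. cmod (h t - trig_sum S c t) \<le> e / 2"
      using assms(1) \<open>e > 0\<close> unfolding almost_periodic_def by (meson half_gt_zero)
    have "cmod (trig_sum S c t) \<le> e / 2"
      by (rule trig_sum_le_of_approx[OF almost_periodic_continuous[OF assms(1)] assms(2) S(1) _ S(2)]) (use that in simp)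
    then show ?thesis
      using norm_triangle_ineq[of "h t - trig_sum S c t" "trig_sum S c t"] S(2)[of t] by simp
  qed
  then have "cmod (h t) \<le> 0" by (rule field_le_epsilon)
  then show ?thesis by simp
qed

section \<open>Bochner-Fejer summation\<close>

lemma cis_sum: "finite I \<Longrightarrow> cis (\<Sum>i\<in>I. a i) = (\<Prod>i\<in>I. cis (a i))"
  by (induction I rule: finite_induct) (simp_all add: cis_mult[symmetric])

lemma dirichlet_kernel_symmetric:
  "(\<Sum>r\<in>{- int n..int n}. cis (of_int r * y)) =
     1 + (\<Sum>i<n. cis (real (Suc i) * y) + cis (- real (Suc i) * y))"
proof (induction n)
  case (Suc n)
  have "{- int (Suc n)..int (Suc n)} = insert (int (Suc n)) (insert (- int (Suc n)) {- int n..int n})"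
    by auto
  then show ?case by (simp add: Suc.IH)
qed simp

text \<open>Raising n by one adds the symmetric Dirichlet kernel on the left. On the right, with D
  the old sum and z the new term cis(n y), the expansion of |D + z|^2 adds 1 and two cross terms,
  which are the same exponentials.\<close>

lemma fejer_kernel_eq:
  "(\<Sum>r\<in>{- int n..int n}. complex_of_real (real n - of_int \<bar>r\<bar>) * cis (of_int r * y)) =
     complex_of_real ((cmod (\<Sum>j<n. cis (real j * y)))\<^sup>2)"
proof (induction n)
  case (Suc n)
  define D where "D = (\<Sum>j<n. cis (real j * y))"
  have "(\<Sum>r\<in>{- int (Suc n)..int (Suc n)}. complex_of_real (real (Suc n) - of_int \<bar>r\<bar>) * cis (of_int r * y)) =
      (\<Sum>r\<in>{- int n..int n}. complex_of_real (real (Suc n) - of_int \<bar>r\<bar>) * cis (of_int r * y))"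
  proof (rule sum.mono_neutral_right)
    show "\<forall>r\<in>{- int (Suc n)..int (Suc n)} - {- int n..int n}.
        complex_of_real (real (Suc n) - of_int \<bar>r\<bar>) * cis (of_int r * y) = 0"
    proof
      fix r assume "r \<in> {- int (Suc n)..int (Suc n)} - {- int n..int n}"
      then have "\<bar>r\<bar> = int (Suc n)" by auto
      then show "complex_of_real (real (Suc n) - of_int \<bar>r\<bar>) * cis (of_int r * y) = 0" by simp
    qed
  qed auto
  also have "\<dots> = (\<Sum>r\<in>{- int n..int n}. complex_of_real (real n - of_int \<bar>r\<bar>) * cis (of_int r * y)) +
      (\<Sum>r\<in>{- int n..int n}. cis (of_int r * y))"
    by (simp add: sum.distrib[symmetric] algebra_simps)
  also have "\<dots> = D * cnj D + (1 + (\<Sum>i<n. cis (real (Suc i) * y)) + (\<Sum>i<n. cis (- real (Suc i) * y)))"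
    by (simp only: Suc.IH dirichlet_kernel_symmetric complex_norm_square D_def sum.distrib add.assoc)
  \<comment> \<open>Reversing the index, i to n - 1 - i, matches the exponents 1, ..., n with n - j
    for j < n.\<close>
  also have "(\<Sum>i<n. cis (real (Suc i) * y)) = cis (real n * y) * cnj D"
    by (subst sum.nat_diff_reindex[symmetric])
      (auto simp: D_def sum_distrib_left cis_cnj cis_mult algebra_simps of_nat_diff intro!: sum.cong)
  also have "(\<Sum>i<n. cis (- real (Suc i) * y)) = cnj (cis (real n * y)) * D"
    by (subst sum.nat_diff_reindex[symmetric])
      (auto simp: D_def sum_distrib_left cis_cnj cis_mult algebra_simps of_nat_diff intro!: sum.cong)
  also have "D * cnj D + (1 + cis (real n * y) * cnj D + cnj (cis (real n * y)) * D) =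
      (D + cis (real n * y)) * cnj (D + cis (real n * y))"
    by (simp add: algebra_simps cis_cnj cis_mult)
  finally show ?case
    by (simp only: complex_norm_square D_def sum.lessThan_Suc)
qed simp

section \<open>Product kernels over the first k basis elements\<close>

definition below :: "enat \<Rightarrow> nat \<Rightarrow> nat set" where
  "below N k = {m \<in> basis_index N. m < k}"

text \<open>The end points k! and -k! are included although their weight is zero and
  \<open>bf_factor\<close> excludes them, so that each coordinate runs over the full range of
  \<open>fejer_kernel_eq\<close>.\<close>

definition bf_box :: "enat \<Rightarrow> nat \<Rightarrow> (nat \<Rightarrow> int) set" where
  "bf_box N k = below N k \<rightarrow>\<^sub>E {- fact k..fact k}"

definition bf_weight :: "enat \<Rightarrow> nat \<Rightarrow> (nat \<Rightarrow> int) \<Rightarrow> real" where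
  "bf_weight N k r = (\<Prod>m\<in>below N k. 1 - of_int \<bar>r m\<bar> / fact k)"

definition bf_freq :: "enat \<Rightarrow> (nat \<Rightarrow> real) \<Rightarrow> nat \<Rightarrow> (nat \<Rightarrow> int) \<Rightarrow> real" where
  "bf_freq N g k r = (\<Sum>m\<in>below N k. of_int (r m) * g m)"

text \<open>The product, over the first k basis elements, of Fejer kernels of order k! in the
  variables \<open>g m * v\<close>, written in expanded form.\<close>

definition bf_kernel :: "enat \<Rightarrow> (nat \<Rightarrow> real) \<Rightarrow> nat \<Rightarrow> real \<Rightarrow> complex" where
  "bf_kernel N g k v = (\<Sum>r\<in>bf_box N k. complex_of_real (bf_weight N k r) * cis (bf_freq N g k r * v))"

text \<open>Zero off the integer span of \<open>g\<close>, where \<open>int_coords\<close> is an undetermined \<open>THE\<close>.\<close>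

definition bf_mult :: "enat \<Rightarrow> (nat \<Rightarrow> real) \<Rightarrow> nat \<Rightarrow> real \<Rightarrow> real" where
  "bf_mult N g k \<mu> =
     (if \<exists>r. int_combination N g \<mu> r then bf_factor N k (int_coords N g \<mu>) else 0)"

lemma finite_below [simp]: "finite (below N k)"
  by (simp add: below_def)

lemma finite_bf_box [simp]: "finite (bf_box N k)"
  by (simp add: bf_box_def finite_PiE)

text \<open>Weight and character both factor over the coordinates, so the sum over the box is a
  product of one-dimensional Fejer kernels, each a squared modulus divided by k!.\<close>

lemma bf_kernel_nonneg:
  obtains x where "bf_kernel N g k v = complex_of_real x" "x \<ge> 0"
proof -
  define F where "F m = (cmod (\<Sum>j<fact k. cis (real j * (g m * v))))\<^sup>2 / fact k" for m
  have "bf_kernel N g k v = (\<Sum>r\<in>bf_box N k. \<Prod>m\<in>below N k.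
      complex_of_real (1 - of_int \<bar>r m\<bar> / fact k) * cis (of_int (r m) * (g m * v)))"
    unfolding bf_kernel_def bf_weight_def bf_freq_def
    by (intro sum.cong refl) (simp add: sum_distrib_right cis_sum prod.distrib mult.assoc)
  also have "\<dots> = (\<Prod>m\<in>below N k. \<Sum>r\<in>{- fact k..fact k}.
      complex_of_real (1 - of_int \<bar>r\<bar> / fact k) * cis (of_int r * (g m * v)))"
    unfolding bf_box_def by (rule prod_sum_PiE[symmetric]) auto
  also have "\<dots> = (\<Prod>m\<in>below N k. complex_of_real (F m))"
  proof (rule prod.cong[OF refl])
    fix m
    have "(\<Sum>r\<in>{- fact k..fact k}. complex_of_real (1 - of_int \<bar>r\<bar> / fact k) * cis (of_int r * (g m * v))) =
        (\<Sum>r\<in>{- int (fact k)..int (fact k)}.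
           complex_of_real (real (fact k) - of_int \<bar>r\<bar>) * cis (of_int r * (g m * v))) / fact k"
      unfolding sum_divide_distrib by (intro sum.cong) (auto simp: field_simps)
    also have "\<dots> = complex_of_real (F m)"
      unfolding fejer_kernel_eq F_def by simp
    finally show "(\<Sum>r\<in>{- fact k..fact k}. complex_of_real (1 - of_int \<bar>r\<bar> / fact k) *
        cis (of_int r * (g m * v))) = complex_of_real (F m)" .
  qed
  also have "\<dots> = complex_of_real (\<Prod>m\<in>below N k. F m)" by simp
  finally show ?thesis
    by (rule that) (auto simp: F_def intro: prod_nonneg)
qed

locale rat_basis =
  fixes N :: enat and g :: "nat \<Rightarrow> real"
  assumes inj: "inj_on g (basis_index N)"
    and indep: "real_rat.independent (g ` basis_index N)"
begin

lemma int_coords_eq: "int_combination N g \<mu> r \<Longrightarrow> int_coords N g \<mu> = r"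
  unfolding int_coords_def using int_combination_unique[OF inj indep] by blast

lemma bf_mult_eq: "int_combination N g \<mu> r \<Longrightarrow> bf_mult N g k \<mu> = bf_factor N k r"
  by (auto simp: bf_mult_def int_coords_eq)

lemma int_combination_bf_freq:
  "int_combination N g (bf_freq N g k r) (\<lambda>m. if m \<in> below N k then r m else 0)"
proof -
  have "{m. (if m \<in> below N k then r m else 0) \<noteq> 0} \<subseteq> below N k" by auto
  moreover have "(\<Sum>m\<in>{m. (if m \<in> below N k then r m else 0) \<noteq> 0}.
      of_int (if m \<in> below N k then r m else 0) * g m) = bf_freq N g k r"
    unfolding bf_freq_def by (rule sum.mono_neutral_cong_left) auto
  ultimately show ?thesis
    unfolding int_combination_def
    by (auto simp: below_def intro: finite_subset[OF _ finite_below[of N k]])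
qed

lemma bf_mult_bf_freq:
  assumes "r \<in> bf_box N k"
  shows "bf_mult N g k (bf_freq N g k r) = bf_weight N k r"
proof -
  \<comment> \<open>Members of the box are \<open>undefined\<close> outside
    \<open>below N k\<close>, whereas integer coordinates are 0 there.\<close>
  define r' where "r' = (\<lambda>m. if m \<in> below N k then r m else 0)"
  have "bf_factor N k r' = bf_weight N k r"
  proof (cases "\<forall>m<k. \<bar>r' m\<bar> < fact k")
    case True
    have "\<forall>m\<ge>k. r' m = 0" by (auto simp: r'_def below_def)
    with True have "bf_factor N k r' = (\<Prod>m\<in>below N k. 1 - of_int \<bar>r' m\<bar> / fact k)"
      by (simp add: bf_factor_def below_def)
    also have "\<dots> = bf_weight N k r"
      unfolding bf_weight_def by (intro prod.cong) (auto simp: r'_def)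
    finally show ?thesis .
  next
    \<comment> \<open>Here some coordinate has absolute value exactly k!: the strict test in
      \<open>bf_factor\<close> gives 0, and so does the corresponding factor of the weight.\<close>
    case False
    then obtain m where m: "m < k" "\<bar>r' m\<bar> \<ge> fact k" by (auto simp: not_less)
    have "r' m \<noteq> 0"
      using m(2) fact_gt_zero[of k, where 'a = int] by linarith
    then have mb: "m \<in> below N k" by (simp add: r'_def split: if_splits)
    then have "r m \<in> {- fact k..fact k}" using assms by (auto simp: bf_box_def)
    then have "\<bar>r m\<bar> = fact k" using m(2) mb by (auto simp: r'_def)
    then have "1 - of_int \<bar>r m\<bar> / (fact k :: real) = 0" by (simp del: of_int_abs)
    then have "bf_weight N k r = 0"
      unfolding bf_weight_def by (intro prod_zero finite_below bexI[OF _ mb])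
    moreover have "bf_factor N k r' = 0" using False by (auto simp: bf_factor_def)
    ultimately show ?thesis by simp
  qed
  then show ?thesis using bf_mult_eq[OF int_combination_bf_freq] by (simp add: r'_def)
qed

text \<open>Rational independence enters here: no two terms of the kernel share a frequency, so sums
  over coordinate vectors can be reindexed by frequencies.\<close>

lemma inj_on_bf_freq: "inj_on (bf_freq N g k) (bf_box N k)"
proof (rule inj_onI)
  fix r r' assume r: "r \<in> bf_box N k" "r' \<in> bf_box N k" and eq: "bf_freq N g k r = bf_freq N g k r'"
  have "(\<lambda>m. if m \<in> below N k then r m else 0) = (\<lambda>m. if m \<in> below N k then r' m else 0)"
    using int_combination_unique[OF inj indep int_combination_bf_freq int_combination_bf_freq[of k r', folded eq]] .
  then have "r m = r' m" if "m \<in> below N k" for m using that by (metis (full_types))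
  then show "r = r'" using r unfolding bf_box_def by (blast intro: PiE_ext)
qed

lemma bf_mult_eq_0:
  assumes "\<mu> \<notin> bf_freq N g k ` bf_box N k"
  shows "bf_mult N g k \<mu> = 0"
proof (rule ccontr)
  assume nz: "bf_mult N g k \<mu> \<noteq> 0"
  then obtain r where r: "int_combination N g \<mu> r" by (auto simp: bf_mult_def split: if_splits)
  with nz have nz: "bf_factor N k r \<noteq> 0" by (simp add: bf_mult_eq)
  then have *: "\<And>m. m \<ge> k \<Longrightarrow> r m = 0" "\<And>m. m < k \<Longrightarrow> \<bar>r m\<bar> < fact k"
    by (auto simp: bf_factor_def split: if_splits)
  have "restrict r (below N k) \<in> bf_box N k"
    unfolding bf_box_def using *(2) by (force simp: below_def abs_less_iff)
  moreover have "{m. r m \<noteq> 0} \<subseteq> below N k"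
    using r *(1) by (auto simp: int_combination_def below_def not_less[symmetric])
  then have "(\<Sum>m\<in>{m. r m \<noteq> 0}. of_int (r m) * g m) = bf_freq N g k (restrict r (below N k))"
    unfolding bf_freq_def by (intro sum.mono_neutral_cong_left) auto
  then have "\<mu> = bf_freq N g k (restrict r (below N k))"
    using r by (simp add: int_combination_def)
  ultimately show False using assms by blast
qed

text \<open>Passes from coordinate vectors to frequencies. Any finite \<open>U\<close> that catches
  the nonzero terms may serve as index set; both sums are compared over the union of
  \<open>U\<close> and the box frequencies.\<close>

lemma sum_bf_box:
  assumes "finite U" "\<And>\<mu>. \<mu> \<notin> U \<Longrightarrow> bf_mult N g k \<mu> = 0 \<or> G \<mu> = 0"
  shows "(\<Sum>r\<in>bf_box N k. complex_of_real (bf_weight N k r) * G (bf_freq N g k r)) =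
    (\<Sum>\<mu>\<in>U. complex_of_real (bf_mult N g k \<mu>) * G \<mu>)"
proof -
  have "(\<Sum>r\<in>bf_box N k. complex_of_real (bf_weight N k r) * G (bf_freq N g k r)) =
      (\<Sum>r\<in>bf_box N k. complex_of_real (bf_mult N g k (bf_freq N g k r)) * G (bf_freq N g k r))"
    by (intro sum.cong) (simp_all add: bf_mult_bf_freq)
  also have "\<dots> = (\<Sum>\<mu>\<in>bf_freq N g k ` bf_box N k. complex_of_real (bf_mult N g k \<mu>) * G \<mu>)"
    by (simp add: sum.reindex[OF inj_on_bf_freq])
  also have "\<dots> = (\<Sum>\<mu>\<in>U \<union> bf_freq N g k ` bf_box N k. complex_of_real (bf_mult N g k \<mu>) * G \<mu>)"
    by (intro sum.mono_neutral_left) (use assms(1) bf_mult_eq_0 in auto)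
  also have "\<dots> = (\<Sum>\<mu>\<in>U. complex_of_real (bf_mult N g k \<mu>) * G \<mu>)"
    by (intro sum.mono_neutral_right) (use assms in auto)
  finally show ?thesis .
qed

lemma bf_mult_0: "bf_mult N g k 0 = 1"
proof -
  have "int_combination N g 0 (\<lambda>_. 0)" by (simp add: int_combination_def)
  then show ?thesis by (simp add: bf_mult_eq bf_factor_def)
qed

text \<open>Once k exceeds the support of \<open>r\<close> and all |r m|, the factor is a product of
  1 - |r m| / k! over that fixed finite support.\<close>

lemma bf_mult_tendsto:
  assumes "int_combination N g \<mu> r"
  shows "(\<lambda>k. bf_mult N g k \<mu>) \<longlonglongrightarrow> 1"
proof -
  define S where "S = {m. r m \<noteq> 0}"
  have S: "finite S" "S \<subseteq> basis_index N"
    using assms by (auto simp: S_def int_combination_def)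
  have "\<forall>\<^sub>F k in sequentially. \<forall>m\<in>S. m < k \<and> nat \<bar>r m\<bar> < k"
    by (intro eventually_ball_finite S ballI eventually_conj eventually_gt_at_top)
  then have "\<forall>\<^sub>F k in sequentially. (\<Prod>m\<in>S. 1 - of_int \<bar>r m\<bar> / fact k) = bf_mult N g k \<mu>"
  proof eventually_elim
    fix k assume k: "\<forall>m\<in>S. m < k \<and> nat \<bar>r m\<bar> < k"
    have small: "\<bar>r m\<bar> < fact k" for m
    proof (cases "m \<in> S")
      case True
      then have "\<bar>r m\<bar> < int k" using k by (simp add: nat_less_iff)
      also have "int k \<le> fact k" by (metis fact_ge_self of_nat_fact of_nat_le_iff)
      finally show ?thesis .
    qed (simp add: S_def)
    have "\<forall>m\<ge>k. r m = 0" using k by (force simp: S_def)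
    then have "bf_mult N g k \<mu> = (\<Prod>m\<in>{m \<in> basis_index N. m < k}. 1 - of_int \<bar>r m\<bar> / fact k)"
      using small by (simp add: bf_mult_eq[OF assms] bf_factor_def)
    also have "\<dots> = (\<Prod>m\<in>S. 1 - of_int \<bar>r m\<bar> / fact k)"
      by (rule prod.mono_neutral_right) (use S k in \<open>auto simp: S_def\<close>)
    finally show "(\<Prod>m\<in>S. 1 - of_int \<bar>r m\<bar> / fact k) = bf_mult N g k \<mu>" by simp
  qed
  moreover have "(\<lambda>k. \<Prod>m\<in>S. 1 - of_int \<bar>r m\<bar> / (fact k :: real)) \<longlonglongrightarrow> (\<Prod>m\<in>S. 1 - of_int \<bar>r m\<bar> * 0)"
  proof (intro tendsto_prod tendsto_diff tendsto_const)
    fix m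
    \<comment> \<open>1 / k! tends to 0 as the general term of the exponential series at 1.\<close>
    have "(\<lambda>k. inverse (fact k) * 1 ^ k :: real) \<longlonglongrightarrow> 0"
      by (rule summable_LIMSEQ_zero[OF summable_exp])
    then have "(\<lambda>k. of_int \<bar>r m\<bar> * (inverse (fact k) * 1 ^ k) :: real) \<longlonglongrightarrow> of_int \<bar>r m\<bar> * 0"
      by (rule tendsto_mult_left)
    then show "(\<lambda>k. of_int \<bar>r m\<bar> / fact k :: real) \<longlonglongrightarrow> of_int \<bar>r m\<bar> * 0"
      by (simp add: divide_inverse)
  qed
  ultimately show ?thesis
    by (simp add: tendsto_cong)
qed

lemma bf_mult_convergent: "convergent (\<lambda>k. bf_mult N g k \<mu>)"
proof (cases "\<exists>r. int_combination N g \<mu> r")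
  case True
  then show ?thesis using bf_mult_tendsto by (auto simp: convergent_def)
qed (simp add: bf_mult_def convergent_const)

section \<open>Bochner-Fejer sums as mean convolutions\<close>

definition bf_op :: "(real \<Rightarrow> complex) \<Rightarrow> nat \<Rightarrow> real \<Rightarrow> complex" where
  "bf_op A k t =
     (\<Sum>r\<in>bf_box N k. complex_of_real (bf_weight N k r) * (A (bf_freq N g k r) * cis (bf_freq N g k r * t)))"

lemma has_mean_bf_kernel:
  assumes "continuous_on UNIV h" "\<And>\<mu>. has_mean (\<lambda>u. h u * cis (- \<mu> * u)) (A \<mu>)"
  shows "has_mean (\<lambda>u. h u * bf_kernel N g k (t - u)) (bf_op A k t)"
proof -
  have "has_mean (\<lambda>u. \<Sum>r\<in>bf_box N k. complex_of_real (bf_weight N k r) *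
      (cis (bf_freq N g k r * t) * (h u * cis (- bf_freq N g k r * u))))
      (\<Sum>r\<in>bf_box N k. complex_of_real (bf_weight N k r) * (cis (bf_freq N g k r * t) * A (bf_freq N g k r)))"
    by (rule has_mean_sum[OF finite_bf_box])
      (intro continuous_on_mult continuous_on_const continuous_on_cis_mult assms(1),
       intro has_mean_cmult assms(2))
  moreover have "(\<Sum>r\<in>bf_box N k. complex_of_real (bf_weight N k r) *
      (cis (bf_freq N g k r * t) * (h u * cis (- bf_freq N g k r * u)))) = h u * bf_kernel N g k (t - u)" for u
    unfolding bf_kernel_def sum_distrib_left
    by (intro sum.cong) (auto simp: right_diff_distrib cis_mult)
  ultimately show ?thesis
    by (simp add: bf_op_def mult_ac)
qed

lemma continuous_on_bf_kernel: "continuous_on A (\<lambda>u. bf_kernel N g k (t - u))"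
  unfolding bf_kernel_def by (intro continuous_intros)

text \<open>The constant function 1 has the single frequency 0, where the multiplier is 1.\<close>

lemma has_mean_bf_kernel_1: "has_mean (\<lambda>u. bf_kernel N g k (t - u)) 1"
proof -
  define A where "A \<mu> = (if \<mu> = 0 then 1 else 0 :: complex)" for \<mu> :: real
  have "has_mean (\<lambda>u. 1 * cis (- \<mu> * u)) (A \<mu>)" for \<mu>
    using has_mean_cis[of "- \<mu>"] by (simp add: A_def)
  then have "has_mean (\<lambda>u. 1 * bf_kernel N g k (t - u)) (bf_op A k t)"
    by (rule has_mean_bf_kernel[rotated]) simp
  moreover have "bf_op A k t = (\<Sum>\<mu>\<in>{0}. complex_of_real (bf_mult N g k \<mu>) * (A \<mu> * cis (\<mu> * t)))"
    unfolding bf_op_def by (rule sum_bf_box) (auto simp: A_def)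
  ultimately show ?thesis by (simp add: bf_mult_0 A_def)
qed

text \<open>Convolution with a nonnegative kernel of mean 1 is a sup norm contraction, whatever k
  is. It is applied to the difference between \<open>h\<close> and the trigonometric sum, on which
  the operator acts by multipliers.\<close>

lemma bf_op_approx:
  assumes "continuous_on UNIV h" "\<And>\<mu>. has_mean (\<lambda>u. h u * cis (- \<mu> * u)) (A \<mu>)"
    and S: "finite S" and le: "\<And>u. cmod (h u - trig_sum S c u) \<le> e"
  shows "cmod (bf_op A k t - (\<Sum>\<mu>\<in>S. complex_of_real (bf_mult N g k \<mu>) * (c \<mu> * cis (\<mu> * t)))) \<le> e"
proof -
  define C where "C \<mu> = (if \<mu> \<in> S then c \<mu> else 0)" for \<mu>
  have C: "has_mean (\<lambda>u. trig_sum S c u * cis (- \<mu> * u)) (C \<mu>)" for \<mu>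
    using has_mean_trig_sum_cis[OF S, of c "- \<mu>"] by (cases "\<mu> \<in> S") (simp_all add: C_def)
  have "bf_op C k t = (\<Sum>\<mu>\<in>S. complex_of_real (bf_mult N g k \<mu>) * (C \<mu> * cis (\<mu> * t)))"
    unfolding bf_op_def by (rule sum_bf_box) (auto simp: C_def S)
  also have "\<dots> = (\<Sum>\<mu>\<in>S. complex_of_real (bf_mult N g k \<mu>) * (c \<mu> * cis (\<mu> * t)))"
    by (intro sum.cong) (auto simp: C_def)
  finally have eq: "bf_op C k t = \<dots>" .
  have "cmod (bf_op A k t - bf_op C k t) \<le> e"
  proof (rule has_mean_bound)
    show "has_mean (\<lambda>u. h u * bf_kernel N g k (t - u) - trig_sum S c u * bf_kernel N g k (t - u))
        (bf_op A k t - bf_op C k t)"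
      by (intro has_mean_diff has_mean_bf_kernel assms C continuous_on_trig_sum continuous_on_mult
          continuous_on_bf_kernel)
    show "continuous_on UNIV (\<lambda>u. h u * bf_kernel N g k (t - u) - trig_sum S c u * bf_kernel N g k (t - u))"
      by (intro continuous_on_diff continuous_on_mult continuous_on_trig_sum assms continuous_on_bf_kernel)
    show "continuous_on UNIV (\<lambda>u. e * cmod (bf_kernel N g k (t - u)))"
      by (intro continuous_on_mult continuous_on_const continuous_on_norm continuous_on_bf_kernel)
    have K: "complex_of_real (cmod (bf_kernel N g k v)) = bf_kernel N g k v" for v
      using bf_kernel_nonneg[of N g k v] by (metis norm_of_real abs_of_nonneg)
    show "has_mean (\<lambda>u. complex_of_real (e * cmod (bf_kernel N g k (t - u)))) (complex_of_real e)"
      using has_mean_cmult[OF has_mean_bf_kernel_1, of "complex_of_real e"] by (simp add: K)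
    show "cmod (h u * bf_kernel N g k (t - u) - trig_sum S c u * bf_kernel N g k (t - u)) \<le>
        e * cmod (bf_kernel N g k (t - u))" for u
      using mult_right_mono[OF le, of "cmod (bf_kernel N g k (t - u))"]
      by (simp add: left_diff_distrib[symmetric] norm_mult)
  qed
  then show ?thesis by (simp only: eq)
qed

text \<open>For an approximating trigonometric sum only finitely many convergent multipliers matter,
  and the contraction carries this over to \<open>h\<close>. Multipliers off the integer span are
  constantly 0, so the frequencies of the sum may be arbitrary.\<close>

lemma uniformly_Cauchy_bf_op:
  assumes "almost_periodic h" "\<And>\<mu>. has_mean (\<lambda>u. h u * cis (- \<mu> * u)) (A \<mu>)"
  shows "uniformly_Cauchy_on UNIV (bf_op A)"
  unfolding uniformly_Cauchy_on_def
proof (intro allI impI)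
  fix e :: real assume "e > 0"
  obtain S c where S: "finite S" "\<And>t. cmod (h t - trig_sum S c t) \<le> e / 4"
    using assms(1) \<open>e > 0\<close> unfolding almost_periodic_def by (meson divide_pos_pos zero_less_numeral)
  define Q where "Q k t = (\<Sum>\<mu>\<in>S. complex_of_real (bf_mult N g k \<mu>) * (c \<mu> * cis (\<mu> * t)))" for k t
  \<comment> \<open>If the multipliers differ by at most \<open>d\<close>, then \<open>Q\<close>
    changes by at most e / 4. The summand 1 keeps the denominator positive.\<close>
  define d where "d = e / (4 * (1 + (\<Sum>\<mu>\<in>S. cmod (c \<mu>))))"
  have s: "0 \<le> (\<Sum>\<mu>\<in>S. cmod (c \<mu>))" by (simp add: sum_nonneg)
  then have d: "d > 0" "d * (\<Sum>\<mu>\<in>S. cmod (c \<mu>)) \<le> e / 4"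
    using \<open>e > 0\<close> by (auto simp: d_def field_simps)
  have "\<forall>\<mu>. \<exists>M. \<forall>m\<ge>M. \<forall>n\<ge>M. dist (bf_mult N g m \<mu>) (bf_mult N g n \<mu>) < d"
    using bf_mult_convergent d(1) by (metis convergent_Cauchy metric_CauchyD)
  then obtain M where M: "\<And>\<mu> m n. m \<ge> M \<mu> \<Longrightarrow> n \<ge> M \<mu> \<Longrightarrow> dist (bf_mult N g m \<mu>) (bf_mult N g n \<mu>) < d"
    by metis
  obtain M0 where M0: "\<And>\<mu>. \<mu> \<in> S \<Longrightarrow> M \<mu> \<le> M0"
    using S(1) by (metis finite_nat_set_iff_bounded_le finite_imageI imageI)
  have "dist (bf_op A m t) (bf_op A n t) < e" if "m \<ge> M0" "n \<ge> M0" for m n t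
  proof -
    have "Q m t - Q n t =
        (\<Sum>\<mu>\<in>S. complex_of_real (bf_mult N g m \<mu> - bf_mult N g n \<mu>) * (c \<mu> * cis (\<mu> * t)))"
      by (simp add: Q_def sum_subtractf[symmetric] left_diff_distrib)
    also have "cmod \<dots> \<le> (\<Sum>\<mu>\<in>S. d * cmod (c \<mu>))"
    proof (rule sum_norm_le)
      fix \<mu> assume "\<mu> \<in> S"
      then have "\<bar>bf_mult N g m \<mu> - bf_mult N g n \<mu>\<bar> \<le> d"
        using M[of \<mu> m n] M0[of \<mu>] that by (simp add: dist_real_def)
      then show "cmod (complex_of_real (bf_mult N g m \<mu> - bf_mult N g n \<mu>) * (c \<mu> * cis (\<mu> * t)))
          \<le> d * cmod (c \<mu>)"
        by (simp add: norm_mult mult_right_mono del: of_real_diff)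
    qed
    also have "\<dots> \<le> e / 4" using d(2) by (simp add: sum_distrib_left)
    finally have "cmod (Q m t - Q n t) \<le> e / 4" .
    moreover have "cmod (bf_op A k t - Q k t) \<le> e / 4" for k
      unfolding Q_def by (rule bf_op_approx[OF almost_periodic_continuous[OF assms(1)] assms(2) S])
    moreover have "bf_op A m t - bf_op A n t =
        (bf_op A m t - Q m t) + (Q m t - Q n t) - (bf_op A n t - Q n t)" by simp
    ultimately have "cmod (bf_op A m t - bf_op A n t) \<le> e / 4 + e / 4 + e / 4"
      by (smt (verit) norm_triangle_ineq norm_triangle_ineq4)
    then show ?thesis using \<open>e > 0\<close> by (simp add: dist_norm)
  qed
  then show "\<exists>M. \<forall>x\<in>UNIV. \<forall>m\<ge>M. \<forall>n\<ge>M. dist (bf_op A m x) (bf_op A n x) < e" by blast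
qed

lemma has_mean_bf_op_cis:
  "has_mean (\<lambda>t. bf_op A k t * cis (- \<mu> * t)) (complex_of_real (bf_mult N g k \<mu>) * A \<mu>)"
proof -
  define G where "G \<nu> = (if \<nu> = \<mu> then A \<mu> else 0)" for \<nu>
  have "has_mean (\<lambda>t. \<Sum>r\<in>bf_box N k. complex_of_real (bf_weight N k r) *
      (A (bf_freq N g k r) * cis ((bf_freq N g k r - \<mu>) * t)))
      (\<Sum>r\<in>bf_box N k. complex_of_real (bf_weight N k r) *
        (A (bf_freq N g k r) * (if bf_freq N g k r - \<mu> = 0 then 1 else 0)))"
    by (rule has_mean_sum[OF finite_bf_box])
      (intro continuous_on_mult continuous_on_const continuous_on_cis_mult,
       intro has_mean_cmult has_mean_cis)
  moreover have "(\<Sum>r\<in>bf_box N k. complex_of_real (bf_weight N k r) *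
      (A (bf_freq N g k r) * (if bf_freq N g k r - \<mu> = 0 then 1 else 0))) =
      (\<Sum>r\<in>bf_box N k. complex_of_real (bf_weight N k r) * G (bf_freq N g k r))"
    by (intro sum.cong) (auto simp: G_def)
  moreover have "\<dots> = (\<Sum>\<nu>\<in>{\<mu>}. complex_of_real (bf_mult N g k \<nu>) * G \<nu>)"
    by (rule sum_bf_box) (auto simp: G_def)
  moreover have "(\<Sum>r\<in>bf_box N k. complex_of_real (bf_weight N k r) *
      (A (bf_freq N g k r) * cis ((bf_freq N g k r - \<mu>) * t))) = bf_op A k t * cis (- \<mu> * t)" for t
    unfolding bf_op_def sum_distrib_right
    by (intro sum.cong) (auto simp: left_diff_distrib mult.assoc cis_mult)
  ultimately show ?thesis by (simp add: G_def)
qed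

lemma almost_periodic_bf_op: "almost_periodic (bf_op A k)"
proof -
  have "bf_op A k t = (\<Sum>r\<in>bf_box N k. (complex_of_real (bf_weight N k r) * A (bf_freq N g k r)) *
      cis (bf_freq N g k r * t))" for t
    by (simp add: bf_op_def mult.assoc)
  then have "bf_op A k t = trig_sum (bf_freq N g k ` bf_box N k)
      (\<lambda>\<mu>. \<Sum>r | r \<in> bf_box N k \<and> bf_freq N g k r = \<mu>. complex_of_real (bf_weight N k r) * A (bf_freq N g k r)) t" for t
    by (simp only: sum_cis_eq_trig_sum[OF finite_bf_box])
  then have "bf_op A k = trig_sum (bf_freq N g k ` bf_box N k)
      (\<lambda>\<mu>. \<Sum>r | r \<in> bf_box N k \<and> bf_freq N g k r = \<mu>. complex_of_real (bf_weight N k r) * A (bf_freq N g k r))"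
    by (rule ext)
  then show ?thesis by (simp add: almost_periodic_trig_sum)
qed

text \<open>The third hypothesis makes the multiplier tend to 1 wherever the coefficient is nonzero,
  so the uniform limit has the coefficients of \<open>h\<close> and uniqueness applies.\<close>

lemma uniform_limit_bf_op:
  assumes "almost_periodic h" "\<And>\<mu>. has_mean (\<lambda>u. h u * cis (- \<mu> * u)) (A \<mu>)"
    and A: "\<And>\<mu>. A \<mu> \<noteq> 0 \<Longrightarrow> \<exists>r. int_combination N g \<mu> r"
  shows "uniform_limit UNIV (bf_op A) h sequentially"
proof -
  obtain l where l: "uniform_limit UNIV (bf_op A) l sequentially"
    using Cauchy_uniformly_convergent[OF uniformly_Cauchy_bf_op[OF assms(1,2)]]
    by (auto simp: uniformly_convergent_on_def)
  have apl: "almost_periodic l" by (rule almost_periodic_uniform_limit[OF almost_periodic_bf_op l])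
  have meanl: "has_mean (\<lambda>t. l t * cis (- \<mu> * t)) (A \<mu>)" for \<mu>
  proof (rule has_mean_uniform_limit[OF _ has_mean_bf_op_cis])
    show "continuous_on UNIV (\<lambda>t. bf_op A n t * cis (- \<mu> * t))" for n
      by (intro continuous_on_mult almost_periodic_continuous[OF almost_periodic_bf_op] continuous_on_cis_mult)
    show "uniform_limit UNIV (\<lambda>n t. bf_op A n t * cis (- \<mu> * t)) (\<lambda>t. l t * cis (- \<mu> * t)) sequentially"
    proof (rule uniform_limitI)
      fix e :: real assume "e > 0"
      show "\<forall>\<^sub>F n in sequentially. \<forall>t\<in>UNIV. dist (bf_op A n t * cis (- \<mu> * t)) (l t * cis (- \<mu> * t)) < e"
        using uniform_limitD[OF l \<open>e > 0\<close>]
        by (simp add: dist_norm left_diff_distrib[symmetric] norm_mult)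
    qed
    show "(\<lambda>n. complex_of_real (bf_mult N g n \<mu>) * A \<mu>) \<longlonglongrightarrow> A \<mu>"
    proof (cases "A \<mu> = 0")
      case False
      then obtain r where "int_combination N g \<mu> r" using A by blast
      then have "(\<lambda>n. complex_of_real (bf_mult N g n \<mu>) * A \<mu>) \<longlonglongrightarrow> complex_of_real 1 * A \<mu>"
        by (intro tendsto_mult_right tendsto_of_real bf_mult_tendsto)
      then show ?thesis by simp
    qed simp
  qed
  have "h t - l t = 0" for t
  proof (rule almost_periodic_eq_0)
    show "almost_periodic (\<lambda>t. h t - l t)" by (rule almost_periodic_diff[OF assms(1) apl])
    fix \<mu>
    \<comment> \<open>Coefficients are means against \<open>cis (- \<mu> * t)\<close>, the
      uniqueness lemma tests against \<open>cis (\<mu> * t)\<close>; hence the double sign.\<close>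
    have "has_mean (\<lambda>t. h t * cis (- (- \<mu>) * t) - l t * cis (- (- \<mu>) * t)) (A (- \<mu>) - A (- \<mu>))"
      by (intro has_mean_diff assms(2) meanl continuous_on_mult almost_periodic_continuous apl assms(1)
          continuous_on_cis_mult)
    then show "has_mean (\<lambda>t. (h t - l t) * cis (\<mu> * t)) 0" by (simp add: left_diff_distrib)
  qed
  then have "l = h" by (auto simp: fun_eq_iff)
  with l show ?thesis by simp
qed

end

section \<open>Dirichlet coefficients on vertical lines\<close>

text \<open>The definition of \<open>AP\<close> asks for strips of positive width. Widening inside
  the open strip allows \<sigma>1 = \<sigma>2, that is, a single line.\<close>

lemma AP_approx:
  assumes "f \<in> AP \<alpha> \<beta>" "\<alpha> < ereal \<sigma>1" "\<sigma>1 \<le> \<sigma>2" "ereal \<sigma>2 < \<beta>" "e > 0"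
  obtains n :: nat and a l where
    "\<And>s. \<sigma>1 \<le> Re s \<Longrightarrow> Re s \<le> \<sigma>2 \<Longrightarrow>
      cmod (f s - (\<Sum>j<n. a j * exp (complex_of_real (l j) * s))) < e"
proof -
  obtain \<alpha>1 where \<alpha>1: "\<alpha> < ereal \<alpha>1" "\<alpha>1 < \<sigma>1"
    using ereal_dense2[OF assms(2)] by auto
  obtain \<beta>1 where \<beta>1: "\<sigma>2 < \<beta>1" "ereal \<beta>1 < \<beta>"
    using ereal_dense2[OF assms(4)] by auto
  have "\<alpha>1 < \<beta>1" using \<alpha>1 \<beta>1 assms(3) by simp
  then obtain P where P: "exp_polynomial P"
      "\<And>s. \<alpha>1 \<le> Re s \<Longrightarrow> Re s \<le> \<beta>1 \<Longrightarrow> cmod (f s - P s) < e"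
    using assms(1,5) \<alpha>1(1) \<beta>1(2) unfolding AP_def by blast
  obtain n :: nat and a l where P': "\<And>s. P s = (\<Sum>j<n. a j * exp (complex_of_real (l j) * s))"
    using P(1) unfolding exp_polynomial_def by blast
  have "cmod (f s - (\<Sum>j<n. a j * exp (complex_of_real (l j) * s))) < e"
    if "\<sigma>1 \<le> Re s" "Re s \<le> \<sigma>2" for s
    using P(2)[of s] that \<alpha>1(2) \<beta>1(1) by (simp add: P')
  then show ?thesis by (rule that)
qed

lemma exp_line: "exp (complex_of_real l * Complex \<sigma> t) = complex_of_real (exp (l * \<sigma>)) * cis (l * t)"
  by (subst exp_eq_polar) simp

lemma almost_periodic_line:
  assumes "f \<in> AP \<alpha> \<beta>" "\<alpha> < ereal \<sigma>" "ereal \<sigma> < \<beta>"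
  shows "almost_periodic (\<lambda>t. f (Complex \<sigma> t))"
  unfolding almost_periodic_def
proof (intro allI impI)
  fix e :: real assume "e > 0"
  obtain n :: nat and a l where *: "\<And>s. \<sigma> \<le> Re s \<Longrightarrow> Re s \<le> \<sigma> \<Longrightarrow>
      cmod (f s - (\<Sum>j<n. a j * exp (complex_of_real (l j) * s))) < e"
    using AP_approx[OF assms(1,2) order_refl assms(3) \<open>e > 0\<close>] by metis
  define c where "c \<mu> = (\<Sum>j | j \<in> {..<n} \<and> l j = \<mu>. a j * complex_of_real (exp (l j * \<sigma>)))" for \<mu>
  have "(\<Sum>j<n. a j * exp (complex_of_real (l j) * Complex \<sigma> t)) = trig_sum (l ` {..<n}) c t" for t
    unfolding c_def by (subst sum_cis_eq_trig_sum[symmetric]) (simp_all add: exp_line mult.assoc)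
  then have "cmod (f (Complex \<sigma> t) - trig_sum (l ` {..<n}) c t) \<le> e" for t
    using *[of "Complex \<sigma> t"] by (simp add: less_imp_le)
  then show "\<exists>S c. finite S \<and> (\<forall>t. cmod (f (Complex \<sigma> t) - trig_sum S c t) \<le> e)"
    by (intro exI[of _ "l ` {..<n}"] exI[of _ c] conjI allI) simp
qed

lemma almost_periodic_has_mean_cis:
  assumes "almost_periodic h"
  shows "\<exists>c. has_mean (\<lambda>t. h t * cis (\<nu> * t)) c"
proof (rule has_mean_exists)
  fix e :: real assume "e > 0"
  then obtain S c where S: "finite S" "\<And>t. cmod (h t - trig_sum S c t) \<le> e"
    using assms unfolding almost_periodic_def by blast
  have "cmod (h t * cis (\<nu> * t) - trig_sum S c t * cis (\<nu> * t)) \<le> e" for t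
    using S(2)[of t] by (simp add: left_diff_distrib[symmetric] norm_mult)
  then show "\<exists>p c. continuous_on UNIV p \<and> has_mean p c \<and> (\<forall>t. cmod (h t * cis (\<nu> * t) - p t) \<le> e)"
    by (intro exI[of _ "\<lambda>t. trig_sum S c t * cis (\<nu> * t)"] exI[of _ "if - \<nu> \<in> S then c (- \<nu>) else 0"]
        conjI allI continuous_on_mult continuous_on_trig_sum continuous_on_cis_mult has_mean_trig_sum_cis S(1)) simp
qed

text \<open>One exponential polynomial approximates \<open>f\<close> on both lines, and its own
  coefficient \<open>b\<close> does not depend on the line, because exp((\<nu> - l) \<sigma>) = 1
  when \<nu> = l.\<close>

lemma line_coeff_independent:
  assumes f: "f \<in> AP \<alpha> \<beta>" and \<sigma>: "\<alpha> < ereal \<sigma>1" "\<sigma>1 \<le> \<sigma>2" "ereal \<sigma>2 < \<beta>"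
    and c1: "has_mean (\<lambda>t. f (Complex \<sigma>1 t) * exp (- (complex_of_real l * Complex \<sigma>1 t))) c1"
    and c2: "has_mean (\<lambda>t. f (Complex \<sigma>2 t) * exp (- (complex_of_real l * Complex \<sigma>2 t))) c2"
  shows "c1 = c2"
proof -
  \<comment> \<open>With approximation error e / E, the weighted errors on the two lines add up to
    e.\<close>
  define E where "E = exp (- l * \<sigma>1) + exp (- l * \<sigma>2)"
  have E: "E > 0" by (simp add: E_def add_pos_pos)
  have ex: "exp (- (complex_of_real l * Complex \<sigma> t)) = complex_of_real (exp (- l * \<sigma>)) * cis (- l * t)" for \<sigma> t
    using exp_line[of "- l" \<sigma> t] by simp
  have "cmod (c1 - c2) \<le> 0 + e" if "e > 0" for e
  proof -
    have "e / E > 0" using that E by simp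
    then obtain n :: nat and a \<nu> where P: "\<And>s. \<sigma>1 \<le> Re s \<Longrightarrow> Re s \<le> \<sigma>2 \<Longrightarrow>
        cmod (f s - (\<Sum>j<n. a j * exp (complex_of_real (\<nu> j) * s))) < e / E"
      using AP_approx[OF f \<sigma>] by metis
    define b where "b = (\<Sum>j<n. a j * (if \<nu> j - l = 0 then 1 else 0))"
    have close: "cmod (c - b) \<le> e / E * exp (- l * \<sigma>)"
      if c: "has_mean (\<lambda>t. f (Complex \<sigma> t) * exp (- (complex_of_real l * Complex \<sigma> t))) c"
        and "\<sigma>1 \<le> \<sigma>" "\<sigma> \<le> \<sigma>2" for \<sigma> c
    proof (rule has_mean_bound_const)
      have "\<alpha> < ereal \<sigma>" "ereal \<sigma> < \<beta>"
        using less_le_trans[OF \<sigma>(1), of "ereal \<sigma>"] le_less_trans[OF _ \<sigma>(3), of "ereal \<sigma>"] that by auto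
      then have "almost_periodic (\<lambda>t. f (Complex \<sigma> t))" by (rule almost_periodic_line[OF f])
      then have fc: "continuous_on UNIV (\<lambda>t. f (Complex \<sigma> t) * exp (- (complex_of_real l * Complex \<sigma> t)))"
        unfolding ex by (intro continuous_on_mult almost_periodic_continuous continuous_on_const continuous_on_cis_mult)
      define p where "p t = (\<Sum>j<n. (a j * complex_of_real (exp ((\<nu> j - l) * \<sigma>))) * cis ((\<nu> j - l) * t))" for t
      have pc: "continuous_on UNIV p"
        unfolding p_def by (intro continuous_on_sum continuous_on_mult continuous_on_const continuous_on_cis_mult)
      have "has_mean p (\<Sum>j<n. (a j * complex_of_real (exp ((\<nu> j - l) * \<sigma>))) * (if \<nu> j - l = 0 then 1 else 0))"
        unfolding p_def
        by (rule has_mean_sum[OF finite_lessThan])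
          (intro continuous_on_mult continuous_on_const continuous_on_cis_mult,
           intro has_mean_cmult has_mean_cis)
      moreover have "(\<Sum>j<n. (a j * complex_of_real (exp ((\<nu> j - l) * \<sigma>))) * (if \<nu> j - l = 0 then 1 else 0)) = b"
        unfolding b_def by (intro sum.cong) auto
      ultimately have pm: "has_mean p b" by simp
      show "has_mean (\<lambda>t. f (Complex \<sigma> t) * exp (- (complex_of_real l * Complex \<sigma> t)) - p t) (c - b)"
        by (rule has_mean_diff[OF fc pc c pm])
      show "continuous_on UNIV (\<lambda>t. f (Complex \<sigma> t) * exp (- (complex_of_real l * Complex \<sigma> t)) - p t)"
        by (rule continuous_on_diff[OF fc pc])
      fix t
      have "p t = (\<Sum>j<n. a j * exp (complex_of_real (\<nu> j) * Complex \<sigma> t)) * exp (- (complex_of_real l * Complex \<sigma> t))"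
        unfolding p_def exp_line ex sum_distrib_right
        by (intro sum.cong refl)
          (simp add: left_diff_distrib exp_diff exp_minus cis_divide[symmetric] cis_inverse[symmetric] field_simps)
      then have "cmod (f (Complex \<sigma> t) * exp (- (complex_of_real l * Complex \<sigma> t)) - p t) =
          cmod (f (Complex \<sigma> t) - (\<Sum>j<n. a j * exp (complex_of_real (\<nu> j) * Complex \<sigma> t))) * exp (- l * \<sigma>)"
        unfolding ex by (simp only: left_diff_distrib[symmetric] norm_mult) simp
      also have "\<dots> \<le> e / E * exp (- l * \<sigma>)"
        using P[of "Complex \<sigma> t"] that by (intro mult_right_mono) auto
      finally show "cmod (f (Complex \<sigma> t) * exp (- (complex_of_real l * Complex \<sigma> t)) - p t) \<le> e / E * exp (- l * \<sigma>)" .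
    qed
    have "cmod (c1 - c2) \<le> cmod (c1 - b) + cmod (c2 - b)"
      using norm_triangle_ineq4[of "c1 - b" "c2 - b"] by simp
    also have "\<dots> \<le> e / E * exp (- l * \<sigma>1) + e / E * exp (- l * \<sigma>2)"
      by (intro add_mono close c1 c2) (use \<sigma>(2) in auto)
    also have "\<dots> = e / E * E" by (simp only: E_def distrib_left)
    also have "\<dots> = e" using E by simp
    finally show ?thesis by simp
  qed
  then have "cmod (c1 - c2) \<le> 0" by (rule field_le_epsilon)
  then show ?thesis by simp
qed

text \<open>This justifies the \<open>THE\<close> in \<open>dirichlet_coeff\<close>: the mean exists
  on each line and is the same on all. The factor exp(l \<sigma>) turns it into the Fourier
  coefficient of the restriction to the line.\<close>

lemma has_mean_dirichlet_coeff:
  assumes f: "f \<in> AP \<alpha> \<beta>" and \<sigma>: "\<alpha> < ereal \<sigma>" "ereal \<sigma> < \<beta>"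
  shows "has_mean (\<lambda>t. f (Complex \<sigma> t) * cis (- l * t))
    (dirichlet_coeff \<alpha> \<beta> f l * complex_of_real (exp (l * \<sigma>)))"
proof -
  let ?m = "\<lambda>\<sigma>. has_mean (\<lambda>t. f (Complex \<sigma> t) * exp (- (complex_of_real l * Complex \<sigma> t)))"
  have ex: "exp (- (complex_of_real l * Complex \<sigma> t)) = complex_of_real (exp (- l * \<sigma>)) * cis (- l * t)" for \<sigma> t
    using exp_line[of "- l" \<sigma> t] by simp
  have exist: "\<exists>c. ?m \<tau> c" if \<tau>: "\<alpha> < ereal \<tau>" "ereal \<tau> < \<beta>" for \<tau>
  proof -
    obtain c where "has_mean (\<lambda>t. f (Complex \<tau> t) * cis (- l * t)) c"
      using almost_periodic_has_mean_cis[OF almost_periodic_line[OF f \<tau>]] by blast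
    from has_mean_cmult[OF this, of "complex_of_real (exp (- l * \<tau>))"] show ?thesis
      unfolding ex by (auto simp: mult_ac)
  qed
  obtain c where c: "?m \<sigma> c" using exist[OF \<sigma>] by blast
  have all: "?m \<tau> c" if \<tau>: "\<alpha> < ereal \<tau>" "ereal \<tau> < \<beta>" for \<tau>
  proof -
    obtain d where d: "?m \<tau> d" using exist[OF \<tau>] by blast
    have "c = d"
    proof (cases "\<sigma> \<le> \<tau>")
      case True
      then show ?thesis using line_coeff_independent[OF f \<sigma>(1) _ \<tau>(2) c d] by simp
    next
      case False
      then show ?thesis using line_coeff_independent[OF f \<tau>(1) _ \<sigma>(2) d c] by simp
    qed
    then show ?thesis using d by simp
  qed
  have "dirichlet_coeff \<alpha> \<beta> f l = c"
    unfolding dirichlet_coeff_def has_mean_def[symmetric]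
  proof (rule the_equality)
    show "\<forall>\<tau>. \<alpha> < ereal \<tau> \<longrightarrow> ereal \<tau> < \<beta> \<longrightarrow> ?m \<tau> c" using all by blast
    fix a assume "\<forall>\<tau>. \<alpha> < ereal \<tau> \<longrightarrow> ereal \<tau> < \<beta> \<longrightarrow> ?m \<tau> a"
    then show "a = c" using \<sigma> has_mean_unique[OF _ c] by blast
  qed
  moreover have "complex_of_real (exp (l * \<sigma>)) * complex_of_real (exp (- l * \<sigma>)) = 1"
    by (simp add: exp_minus)
  then have "complex_of_real (exp (l * \<sigma>)) * (f (Complex \<sigma> t) * exp (- (complex_of_real l * Complex \<sigma> t))) =
      f (Complex \<sigma> t) * cis (- l * t)" for t
    unfolding ex by (metis mult.assoc mult.left_commute mult.left_neutral)
  ultimately show ?thesis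
    using has_mean_cmult[OF c, of "complex_of_real (exp (l * \<sigma>))"] by (simp only: mult.commute)
qed

section \<open>The image of the auxiliary function\<close>

context rat_basis
begin

lemma below_eq_lessThan: obtains n where "below N k = {..<n}"
proof (cases N)
  case (enat n)
  then have "below N k = {..<min n k}" by (auto simp: below_def basis_index_def)
  then show ?thesis by (rule that)
next
  case infinity
  then have "below N k = {..<k}" by (auto simp: below_def basis_index_def)
  then show ?thesis by (rule that)
qed

lemma int_independent_below:
  "module.independent (\<lambda>r. (*) (real_of_int r)) (g ` below N k)"
proof -
  interpret int_mod: module "\<lambda>r. (*) (real_of_int r)"
    by (simp add: module.intro distrib_left mult.commute)
  show ?thesis
    unfolding int_mod.dependent_explicit
  proof (clarify)
    fix t u v assume t: "finite t" "t \<subseteq> g ` below N k" and s: "(\<Sum>v\<in>t. real_of_int (u v) * v) = 0"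
      and v: "v \<in> t" "u v \<noteq> 0"
    have "(\<Sum>v\<in>t. rat_scale (of_int (u v)) v) = 0"
      using s by (simp add: rat_scale_def)
    moreover have "t \<subseteq> g ` basis_index N" using t(2) by (auto simp: below_def)
    ultimately have "(of_int (u v) :: rat) = 0"
      using real_rat.independentD[OF indep t(1), of "\<lambda>v. of_int (u v)" v] v(1) by simp
    then show False using v(2) by simp
  qed
qed

text \<open>Kronecker's theorem modulo 1, applied to x / (2 pi) with tolerance \<epsilon> / (2 pi).
  Multiplying by 2 pi gives approximation modulo 2 pi at time 2 pi t.\<close>

lemma kronecker_below:
  assumes "\<epsilon> > 0"
  obtains t and h :: "nat \<Rightarrow> int" where
    "\<And>m. m \<in> below N k \<Longrightarrow> \<bar>g m * t - 2 * pi * of_int (h m) - x m\<bar> < \<epsilon>"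
proof -
  obtain n where n: "below N k = {..<n}" by (rule below_eq_lessThan)
  have injn: "inj_on g {..<n}"
    using inj unfolding n[symmetric] by (rule inj_on_subset) (auto simp: below_def)
  have "\<epsilon> / (2 * pi) > 0" using assms by simp
  then obtain t h where th: "\<And>i. i < n \<Longrightarrow> \<bar>t * g i - of_int (h i) - x i / (2 * pi)\<bar> < \<epsilon> / (2 * pi)"
    using Kronecker_thm_1[OF int_independent_below[of k, unfolded n] injn, of _ "\<lambda>i. x i / (2 * pi)"] by metis
  have "\<bar>g m * (2 * pi * t) - 2 * pi * of_int (h m) - x m\<bar> < \<epsilon>" if "m \<in> below N k" for m
  proof -
    have "g m * (2 * pi * t) - 2 * pi * of_int (h m) - x m =
        2 * pi * (t * g m - of_int (h m) - x m / (2 * pi))"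
      by (simp add: field_simps)
    then have "\<bar>g m * (2 * pi * t) - 2 * pi * of_int (h m) - x m\<bar> =
        2 * pi * \<bar>t * g m - of_int (h m) - x m / (2 * pi)\<bar>"
      by (simp only: abs_mult) simp
    also have "\<dots> < 2 * pi * (\<epsilon> / (2 * pi))"
      using th[of m] that n by (intro mult_strict_left_mono) auto
    finally show ?thesis by simp
  qed
  then show ?thesis by (rule that)
qed

end

lemma exp_coords_pairing_shift:
  assumes "finite {m. r m \<noteq> 0}" "\<And>m. r m \<noteq> 0 \<Longrightarrow> \<exists>j::int. y m = x m + 2 * pi * of_int j"
  shows "exp (\<i> * complex_of_real (coords_pairing r y)) = exp (\<i> * complex_of_real (coords_pairing r x))"
proof -
  obtain j :: "nat \<Rightarrow> int" where j: "\<And>m. r m \<noteq> 0 \<Longrightarrow> y m = x m + 2 * pi * of_int (j m)"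
    using assms(2) by metis
  have "coords_pairing r y = (\<Sum>m | r m \<noteq> 0. of_int (r m) * x m + 2 * pi * of_int (r m * j m))"
    unfolding coords_pairing_def by (intro sum.cong) (auto simp: j algebra_simps)
  also have "\<dots> = coords_pairing r x + 2 * pi * of_int (\<Sum>m | r m \<noteq> 0. r m * j m)"
    by (simp add: coords_pairing_def sum.distrib sum_distrib_left)
  finally have "cis (coords_pairing r y) = cis (coords_pairing r x) *
      cis (2 * pi * of_int (\<Sum>m | r m \<noteq> 0. r m * j m))"
    by (simp only: cis_mult)
  then show ?thesis
    by (simp only: cis_conv_exp[symmetric] cis_multiple_2pi Ints_of_int mult_1_right)
qed

section \<open>The auxiliary function on one vertical line\<close>

locale D_class_line =
  fixes \<alpha> \<beta> :: ereal and \<Lambda> :: "real set" and N :: enat and g :: "nat \<Rightarrow> real"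
    and f :: "complex \<Rightarrow> complex" and \<sigma> :: real
  assumes basis: "integral_basis \<Lambda> N g" and f: "f \<in> D_class \<alpha> \<beta> \<Lambda>"
    and \<sigma>: "\<alpha> < ereal \<sigma>" "ereal \<sigma> < \<beta>"
begin

sublocale rat_basis N g
  using basis by unfold_locales (auto simp: integral_basis_def)

abbreviation "S k \<equiv> bf_sum \<alpha> \<beta> \<Lambda> N g f k \<sigma>"
abbreviation "F \<equiv> aux_fun \<alpha> \<beta> \<Lambda> N g f \<sigma>"
abbreviation "ic \<equiv> int_coords N g"
abbreviation "supp k \<equiv> {l \<in> \<Lambda>. bf_factor N k (ic l) \<noteq> 0}"

definition line_coeff :: "real \<Rightarrow> complex" where
  "line_coeff l = dirichlet_coeff \<alpha> \<beta> f l * complex_of_real (exp (l * \<sigma>))"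

lemma ic: "l \<in> \<Lambda> \<Longrightarrow> int_combination N g l (ic l)"
  by (rule int_combination_int_coords[OF basis])

lemma finite_ic_support: "l \<in> \<Lambda> \<Longrightarrow> finite {m. ic l m \<noteq> 0}"
  and ic_support_basis: "l \<in> \<Lambda> \<Longrightarrow> ic l m \<noteq> 0 \<Longrightarrow> m \<in> basis_index N"
  using ic[of l] by (auto simp: int_combination_def)

lemma coords_pairing_line: "l \<in> \<Lambda> \<Longrightarrow> coords_pairing (ic l) (\<lambda>m. g m * t) = l * t"
proof -
  assume "l \<in> \<Lambda>"
  then have "(\<Sum>m | ic l m \<noteq> 0. of_int (ic l m) * g m) = l"
    using ic[of l] unfolding int_combination_def by argo
  then show ?thesis by (simp add: coords_pairing_def sum_distrib_right[symmetric] mult.assoc[symmetric])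
qed

text \<open>On the line x = t g the pairing is l t. Passing from the sum over the box to the sum
  over \<Lambda> loses nothing, since the coefficients of \<open>f\<close> vanish outside
  \<Lambda>.\<close>

lemma bf_sum_line: "S k (\<lambda>m. g m * t) = bf_op line_coeff k t"
proof -
  have fin: "finite (supp k)" by (rule finite_bf_support[OF basis])
  have "bf_op line_coeff k t =
      (\<Sum>l\<in>supp k. complex_of_real (bf_mult N g k l) * (line_coeff l * cis (l * t)))"
    unfolding bf_op_def
  proof (rule sum_bf_box[OF fin])
    fix l assume l: "l \<notin> supp k"
    show "bf_mult N g k l = 0 \<or> line_coeff l * cis (l * t) = 0"
    proof (cases "l \<in> \<Lambda>")
      case True
      then show ?thesis using l by (simp add: bf_mult_eq[OF ic])
    next
      case False
      then show ?thesis using f by (auto simp: D_class_def line_coeff_def)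
    qed
  qed
  also have "\<dots> = S k (\<lambda>m. g m * t)"
    unfolding bf_sum_def
    by (intro sum.cong refl)
      (auto simp: bf_mult_eq[OF ic] coords_pairing_line line_coeff_def cis_conv_exp)
  finally show ?thesis by simp
qed

lemma almost_periodic_f: "almost_periodic (\<lambda>t. f (Complex \<sigma> t))"
  using f \<sigma> by (auto simp: D_class_def intro: almost_periodic_line)

lemma has_mean_line_coeff: "has_mean (\<lambda>t. f (Complex \<sigma> t) * cis (- l * t)) (line_coeff l)"
  unfolding line_coeff_def by (rule has_mean_dirichlet_coeff) (use f \<sigma> in \<open>auto simp: D_class_def\<close>)

lemma line_coeff_support: "line_coeff l \<noteq> 0 \<Longrightarrow> \<exists>r. int_combination N g l r"
  using f ic[of l] by (auto simp: line_coeff_def D_class_def)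

text \<open>For k \<le> K the sum sees only the coordinates below K modulo 2 pi, so one sequence of
  times serves all these k at once.\<close>

lemma bf_sum_density:
  obtains t :: "nat \<Rightarrow> real" where
    "\<And>k. k \<le> K \<Longrightarrow> (\<lambda>n. S k (\<lambda>m. g m * t n)) \<longlonglongrightarrow> S k x"
proof -
  have "\<forall>n. \<exists>t h. \<forall>m\<in>below N K. \<bar>g m * t - 2 * pi * of_int (h m) - x m\<bar> < inverse (real (Suc n))"
  proof
    fix n
    have "inverse (real (Suc n)) > 0" by simp
    then show "\<exists>t h. \<forall>m\<in>below N K. \<bar>g m * t - 2 * pi * of_int (h m) - x m\<bar> < inverse (real (Suc n))"
      by (rule kronecker_below[of _ K x]) blast
  qed
  then obtain t :: "nat \<Rightarrow> real" and h :: "nat \<Rightarrow> nat \<Rightarrow> int" where th: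
    "\<And>n m. m \<in> below N K \<Longrightarrow> \<bar>g m * t n - 2 * pi * of_int (h n m) - x m\<bar> < inverse (real (Suc n))"
    by metis
  \<comment> \<open>The point on the line reduced modulo 2 pi: it has the same values of
    \<open>S k\<close>, but its coordinates converge to those of \<open>x\<close>.\<close>
  define y where "y n m = g m * t n - 2 * pi * of_int (h n m)" for n m
  have y: "(\<lambda>n. y n m) \<longlonglongrightarrow> x m" if "m \<in> below N K" for m
  proof (rule LIM_zero_cancel, rule Lim_null_comparison[OF _ LIMSEQ_inverse_real_of_nat])
    show "\<forall>\<^sub>F n in sequentially. norm (y n m - x m) \<le> inverse (real (Suc n))"
      using th[OF that] by (auto simp: y_def less_imp_le)
  qed
  have "(\<lambda>n. S k (\<lambda>m. g m * t n)) \<longlonglongrightarrow> S k x" if "k \<le> K" for k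
    unfolding bf_sum_def
  proof (intro tendsto_sum tendsto_mult tendsto_const)
    fix l assume l: "l \<in> supp k"
    have sub: "m \<in> below N K" if "ic l m \<noteq> 0" for m
    proof -
      have "m < k" using l that by (auto simp: bf_factor_def not_less[symmetric] split: if_splits)
      then show ?thesis using l that \<open>k \<le> K\<close> ic_support_basis[of l m] by (auto simp: below_def)
    qed
    have "(\<lambda>n. coords_pairing (ic l) (y n)) \<longlonglongrightarrow> coords_pairing (ic l) x"
      unfolding coords_pairing_def by (intro tendsto_sum tendsto_mult tendsto_const y) (use sub in auto)
    then have "(\<lambda>n. exp (\<i> * complex_of_real (coords_pairing (ic l) (y n)))) \<longlonglongrightarrow>
        exp (\<i> * complex_of_real (coords_pairing (ic l) x))"
      by (intro tendsto_intros)
    moreover have "exp (\<i> * complex_of_real (coords_pairing (ic l) (\<lambda>m. g m * t n))) =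
        exp (\<i> * complex_of_real (coords_pairing (ic l) (y n)))" for n
      by (rule exp_coords_pairing_shift) (use l finite_ic_support in \<open>auto simp: y_def\<close>)
    ultimately show "(\<lambda>n. exp (\<i> * complex_of_real (coords_pairing (ic l) (\<lambda>m. g m * t n)))) \<longlonglongrightarrow>
        exp (\<i> * complex_of_real (coords_pairing (ic l) x))" by simp
  qed
  then show ?thesis by (rule that)
qed

text \<open>By density a bound for the difference of two sums along the line holds for all x. A
  sequence common to both indices is needed, hence K = max m n.\<close>

lemma uniform_limit_bf_sum: "uniform_limit UNIV S F sequentially"
proof -
  have "uniformly_Cauchy_on UNIV S"
    unfolding uniformly_Cauchy_on_def
  proof (intro allI impI)
    fix e :: real assume "e > 0"
    then obtain M where M: "\<And>t m n. m \<ge> M \<Longrightarrow> n \<ge> M \<Longrightarrow>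
        dist (bf_op line_coeff m t) (bf_op line_coeff n t) < e / 2"
      using uniformly_Cauchy_bf_op[OF almost_periodic_f has_mean_line_coeff]
      unfolding uniformly_Cauchy_on_def by (meson UNIV_I half_gt_zero)
    have "dist (S m x) (S n x) < e" if mn: "m \<ge> M" "n \<ge> M" for m n x
    proof -
      obtain t :: "nat \<Rightarrow> real" where t: "\<And>k. k \<le> max m n \<Longrightarrow> (\<lambda>i. S k (\<lambda>j. g j * t i)) \<longlonglongrightarrow> S k x"
        using bf_sum_density by blast
      have "dist (S m x) (S n x) \<le> e / 2"
      proof (rule LIMSEQ_le_const2[OF tendsto_dist[OF t t]])
        show "\<exists>M. \<forall>i\<ge>M. dist (S m (\<lambda>j. g j * t i)) (S n (\<lambda>j. g j * t i)) \<le> e / 2"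
          using M[OF mn] by (auto simp: bf_sum_line less_imp_le)
      qed auto
      then show ?thesis using \<open>e > 0\<close> by simp
    qed
    then show "\<exists>M. \<forall>x\<in>UNIV. \<forall>m\<ge>M. \<forall>n\<ge>M. dist (S m x) (S n x) < e" by blast
  qed
  then have "uniformly_convergent_on UNIV S"
    by (rule Cauchy_uniformly_convergent)
  then show ?thesis
    by (simp add: uniformly_convergent_uniform_limit_iff aux_fun_def[abs_def])
qed

lemma aux_fun_line: "F (\<lambda>m. g m * t) = f (Complex \<sigma> t)"
proof (rule LIMSEQ_unique)
  show "(\<lambda>k. S k (\<lambda>m. g m * t)) \<longlonglongrightarrow> F (\<lambda>m. g m * t)"
    by (rule tendsto_uniform_limitI[OF uniform_limit_bf_sum UNIV_I])
  show "(\<lambda>k. S k (\<lambda>m. g m * t)) \<longlonglongrightarrow> f (Complex \<sigma> t)"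
    unfolding bf_sum_line
    by (rule tendsto_uniform_limitI[OF uniform_limit_bf_op[OF almost_periodic_f has_mean_line_coeff line_coeff_support] UNIV_I])
qed

lemma aux_fun_cong:
  assumes "\<And>m. m \<in> basis_index N \<Longrightarrow> \<exists>j::int. y m = x m + 2 * pi * of_int j"
  shows "F y = F x"
proof -
  have "S k y = S k x" for k
    unfolding bf_sum_def
  proof (intro sum.cong refl)
    fix l assume "l \<in> supp k"
    then have "exp (\<i> * complex_of_real (coords_pairing (ic l) y)) =
        exp (\<i> * complex_of_real (coords_pairing (ic l) x))"
      by (intro exp_coords_pairing_shift finite_ic_support assms ic_support_basis) auto
    then show "complex_of_real (bf_factor N k (ic l)) * dirichlet_coeff \<alpha> \<beta> f l *
        exp (\<i> * complex_of_real (coords_pairing (ic l) y)) * complex_of_real (exp (l * \<sigma>)) =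
        complex_of_real (bf_factor N k (ic l)) * dirichlet_coeff \<alpha> \<beta> f l *
        exp (\<i> * complex_of_real (coords_pairing (ic l) x)) * complex_of_real (exp (l * \<sigma>))" by simp
  qed
  then show ?thesis by (simp add: aux_fun_def)
qed

text \<open>Identifies the extensional points in \<open>img_aux\<close> with arbitrary ones, so that
  translations and compact cubes can be taken in the whole function space.\<close>

lemma aux_fun_restrict: "F (restrict x (basis_index N)) = F x"
  by (rule aux_fun_cong) (auto intro: exI[of _ 0])

lemma img_aux_eq_range: "img_aux \<alpha> \<beta> \<Lambda> N g f \<sigma> = range F"
proof
  show "range F \<subseteq> img_aux \<alpha> \<beta> \<Lambda> N g f \<sigma>"
  proof clarify
    fix x :: "nat \<Rightarrow> real"
    have "restrict x (basis_index N) \<in> basis_index N \<rightarrow>\<^sub>E UNIV" by auto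
    then show "F x \<in> img_aux \<alpha> \<beta> \<Lambda> N g f \<sigma>"
      unfolding img_aux_def aux_fun_restrict[of x, symmetric] by blast
  qed
qed (auto simp: img_aux_def)

text \<open>Continuity refers to the product topology on \<open>nat => real\<close>; each
  \<open>S k\<close> is a finite sum depending on finitely many coordinates.\<close>

lemma continuous_on_aux_fun: "continuous_on UNIV F"
proof (rule uniform_limit_theorem[OF _ uniform_limit_bf_sum])
  have "continuous_on UNIV (S k)" for k
    unfolding bf_sum_def[abs_def] coords_pairing_def
    by (intro continuous_on_sum continuous_on_mult continuous_on_const continuous_on_exp
        continuous_on_of_real continuous_on_product_coordinates)
  then show "\<forall>\<^sub>F k in sequentially. continuous_on UNIV (S k)" by simp
qed simp

lemma img_aux_eq_closure: "img_aux \<alpha> \<beta> \<Lambda> N g f \<sigma> = closure (img_line f \<sigma>)"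
proof
  show "img_aux \<alpha> \<beta> \<Lambda> N g f \<sigma> \<subseteq> closure (img_line f \<sigma>)"
    unfolding img_aux_eq_range
  proof clarify
    fix x
    show "F x \<in> closure (img_line f \<sigma>)"
      unfolding closure_approachable
    proof (intro allI impI)
      fix e :: real assume "e > 0"
      then have "\<forall>\<^sub>F k in sequentially. \<forall>y\<in>UNIV. dist (S k y) (F y) < e / 3"
        using uniform_limitD[OF uniform_limit_bf_sum, of "e / 3"] by simp
      then obtain k where k: "\<And>y. dist (S k y) (F y) < e / 3"
        by (auto simp: eventually_sequentially)
      obtain t :: "nat \<Rightarrow> real" where "(\<lambda>n. S k (\<lambda>m. g m * t n)) \<longlonglongrightarrow> S k x"
        using bf_sum_density[of k] by blast
      then have "\<forall>\<^sub>F n in sequentially. dist (S k (\<lambda>m. g m * t n)) (S k x) < e / 3"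
        by (rule tendstoD) (use \<open>e > 0\<close> in simp)
      then obtain n where "dist (S k (\<lambda>m. g m * t n)) (S k x) < e / 3"
        by (auto simp: eventually_sequentially)
      then have "dist (F (\<lambda>m. g m * t n)) (F x) < e"
        using k[of "\<lambda>m. g m * t n"] k[of x] by (metis dist_commute dist_triangle_third)
      then show "\<exists>z\<in>img_line f \<sigma>. dist z (F x) < e"
        unfolding aux_fun_line by (auto simp: img_line_def)
    qed
  qed
next
  \<comment> \<open>A cube in all coordinates, compact by Tychonoff, that contains a representative
    modulo 2 pi of every point of the line.\<close>
  define C :: "(nat \<Rightarrow> real) set" where "C = UNIV \<rightarrow>\<^sub>E {0..2 * pi}"
  have "compactin (product_topology (\<lambda>_. euclidean) UNIV) C"
    unfolding C_def by (simp add: compactin_PiE)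
  then have "compact C" by (simp add: euclidean_product_topology)
  then have "compact (F ` C)"
    by (rule compact_continuous_image[rotated]) (rule continuous_on_subset[OF continuous_on_aux_fun subset_UNIV])
  then have "closed (F ` C)" by (rule compact_imp_closed)
  moreover have "img_line f \<sigma> \<subseteq> F ` C"
  proof (clarsimp simp: img_line_def)
    fix t
    define j where "j m = \<lfloor>g m * t / (2 * pi)\<rfloor>" for m
    define x where "x m = g m * t - 2 * pi * of_int (j m)" for m
    have "x m \<in> {0..2 * pi}" for m
    proof -
      have "x m = 2 * pi * frac (g m * t / (2 * pi))"
        by (simp add: x_def j_def frac_def right_diff_distrib)
      then show ?thesis
        using frac_ge_0[of "g m * t / (2 * pi)"] frac_lt_1[of "g m * t / (2 * pi)"] by simp
    qed
    then have "x \<in> C" by (simp add: C_def PiE_iff)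
    moreover have "F (\<lambda>m. g m * t) = F x"
      by (rule aux_fun_cong) (auto simp: x_def)
    ultimately show "f (Complex \<sigma> t) \<in> F ` C" by (simp add: aux_fun_line[symmetric])
  qed
  ultimately have "closure (img_line f \<sigma>) \<subseteq> F ` C" by (rule closure_minimal[rotated])
  then show "closure (img_line f \<sigma>) \<subseteq> img_aux \<alpha> \<beta> \<Lambda> N g f \<sigma>"
    unfolding img_aux_eq_range by blast
qed

end

section \<open>Equivalent functions and translation of the variable\<close>

lemma rat_linear_on_int_combination:
  assumes \<psi>: "rat_linear_on V \<psi>" and V: "real_rat.subspace V" "g ` basis_index N \<subseteq> V"
    and r: "int_combination N g l r"
  shows "\<psi> l = coords_pairing r (\<lambda>m. \<psi> (g m))"
proof -
  have zero: "\<psi> 0 = 0"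
    using \<psi> real_rat.subspace_0[OF V(1)] unfolding rat_linear_on_def
    by (metis rat_scale_def mult_zero_left of_rat_0)
  \<comment> \<open>Membership in \<open>V\<close> is carried along in the induction because \<psi>
    is additive only there.\<close>
  have "\<psi> (\<Sum>m\<in>T. of_int (r m) * g m) = (\<Sum>m\<in>T. of_int (r m) * \<psi> (g m)) \<and>
      (\<Sum>m\<in>T. of_int (r m) * g m) \<in> V" if "finite T" "T \<subseteq> basis_index N" for T
    using that
  proof (induction T)
    case (insert m T)
    have gm: "g m \<in> V" using insert V(2) by auto
    have sc: "of_int (r m) * x = rat_scale (of_int (r m)) x" for x by (simp add: rat_scale_def)
    have "of_int (r m) * g m \<in> V"
      unfolding sc by (rule real_rat.subspace_scale[OF V(1) gm])
    moreover have "\<psi> (of_int (r m) * g m) = of_int (r m) * \<psi> (g m)"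
      unfolding sc using \<psi> gm by (simp add: rat_linear_on_def)
    ultimately show ?case
      using insert \<psi> real_rat.subspace_add[OF V(1)] by (simp add: rat_linear_on_def)
  qed (simp add: zero real_rat.subspace_0[OF V(1)])
  then show ?thesis
    using r unfolding int_combination_def coords_pairing_def by auto
qed

theorem proposition3:
  fixes \<alpha> \<beta> :: ereal and \<Lambda> :: "real set" and N :: enat and g :: "nat \<Rightarrow> real"
    and f f1 :: "complex \<Rightarrow> complex" and s0 :: complex
  assumes "\<alpha> < \<beta>"
    and "countable \<Lambda>"
    and "integral_basis \<Lambda> N g"
    and "f \<in> D_class \<alpha> \<beta> \<Lambda>"
    and "s0 \<in> vstrip \<alpha> \<beta>"
    and "D_equiv \<alpha> \<beta> \<Lambda> f1 f"
  shows "img_aux \<alpha> \<beta> \<Lambda> N g f (Re s0) = closure (img_line f1 (Re s0))"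
proof -
  define \<sigma> where "\<sigma> = Re s0"
  have \<sigma>: "\<alpha> < ereal \<sigma>" "ereal \<sigma> < \<beta>"
    using assms(5) by (auto simp: vstrip_def \<sigma>_def)
  obtain \<psi> where f1: "f1 \<in> D_class \<alpha> \<beta> \<Lambda>" and \<psi>: "rat_linear_on (real_rat.span \<Lambda>) \<psi>"
    and coeff: "\<And>l. l \<in> \<Lambda> \<Longrightarrow> dirichlet_coeff \<alpha> \<beta> f l =
        dirichlet_coeff \<alpha> \<beta> f1 l * exp (\<i> * complex_of_real (\<psi> l))"
    using assms(6) by (auto simp: D_equiv_def)
  interpret L: D_class_line \<alpha> \<beta> \<Lambda> N g f \<sigma> using assms(3,4) \<sigma> by unfold_locales
  interpret L1: D_class_line \<alpha> \<beta> \<Lambda> N g f1 \<sigma> using assms(3) f1 \<sigma> by unfold_locales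
  have gV: "g ` basis_index N \<subseteq> real_rat.span \<Lambda>"
    using assms(3) real_rat.span_superset[of "g ` basis_index N"] by (simp add: integral_basis_def)
  \<comment> \<open>The phase exp(i \<psi>(l)) is the character with the coordinates of
    \<open>l\<close> evaluated at this point. The phases lead from \<open>f1\<close> to
    \<open>f\<close>, so the function of \<open>f\<close> at x is that of \<open>f1\<close> at x +
    y.\<close>
  define y where "y m = \<psi> (g m)" for m
  have shift: "bf_sum \<alpha> \<beta> \<Lambda> N g f k \<sigma> x = bf_sum \<alpha> \<beta> \<Lambda> N g f1 k \<sigma> (\<lambda>m. x m + y m)" for k x
    unfolding bf_sum_def
  proof (intro sum.cong refl)
    fix l assume "l \<in> {l \<in> \<Lambda>. bf_factor N k (int_coords N g l) \<noteq> 0}"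
    then have l: "l \<in> \<Lambda>" by simp
    have "\<psi> l = coords_pairing (int_coords N g l) y"
      unfolding y_def[abs_def]
      by (rule rat_linear_on_int_combination[OF \<psi> real_rat.subspace_span gV L.ic[OF l]])
    then have "exp (\<i> * complex_of_real (coords_pairing (int_coords N g l) (\<lambda>m. x m + y m))) =
        exp (\<i> * complex_of_real (\<psi> l)) * exp (\<i> * complex_of_real (coords_pairing (int_coords N g l) x))"
      by (simp add: coords_pairing_def sum.distrib distrib_left exp_add mult.commute)
    then show "complex_of_real (bf_factor N k (int_coords N g l)) * dirichlet_coeff \<alpha> \<beta> f l *
        exp (\<i> * complex_of_real (coords_pairing (int_coords N g l) x)) * complex_of_real (exp (l * \<sigma>)) =
        complex_of_real (bf_factor N k (int_coords N g l)) * dirichlet_coeff \<alpha> \<beta> f1 l *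
        exp (\<i> * complex_of_real (coords_pairing (int_coords N g l) (\<lambda>m. x m + y m))) *
        complex_of_real (exp (l * \<sigma>))"
      by (simp add: coeff[OF l])
  qed
  have "range (aux_fun \<alpha> \<beta> \<Lambda> N g f \<sigma>) = range (\<lambda>x. aux_fun \<alpha> \<beta> \<Lambda> N g f1 \<sigma> (\<lambda>m. x m + y m))"
    by (simp add: aux_fun_def shift)
  also have "\<dots> = range (aux_fun \<alpha> \<beta> \<Lambda> N g f1 \<sigma>)"
  proof (intro equalityI subsetI; clarify)
    fix x
    \<comment> \<open>Translation by \<open>y\<close> is onto, with preimage x - y, so the range is
      unchanged.\<close>
    have "aux_fun \<alpha> \<beta> \<Lambda> N g f1 \<sigma> x = aux_fun \<alpha> \<beta> \<Lambda> N g f1 \<sigma> (\<lambda>m. (x m - y m) + y m)" by simp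
    then show "aux_fun \<alpha> \<beta> \<Lambda> N g f1 \<sigma> x \<in> range (\<lambda>x. aux_fun \<alpha> \<beta> \<Lambda> N g f1 \<sigma> (\<lambda>m. x m + y m))"
      by (rule range_eqI[where x = "\<lambda>m. x m - y m"])
  qed auto
  finally show ?thesis
    unfolding \<sigma>_def[symmetric] L.img_aux_eq_range L1.img_aux_eq_range[symmetric]
    by (simp add: L1.img_aux_eq_closure)
qed

end
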